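(* The restriction operator $\Gamma:\mathcal R'\to\mathcal D'$, which restricts a functional on $\mathcal R$ to $\mathcal D\subset\mathcal R$, is surjective; that is, every distribution in $\mathcal D'$ has a linear continuous extension from $\mathcal D$ to $\mathcal R$.
   Context: $I=(a,b)\subset\mathbf R$ is an open interval (e.g. $I=\mathbf R$), $\mathbf N_0=\mathbf N\cup\{0\}$; functions are identified when equal almost everywhere. $\mathbb G$ is the algebra of essentially bounded $g:I\to\mathbf C$ possessing both limits $g(t\pm)=\operatorname{ess\,lim}_{s\to t\pm}g(s)$ at every $t\in I$. $\mathbb G^\infty$ is the algebra of $g\in\mathbb G$ such that for every $k\in\mathbf N$ there is $g^{(k)}\in\mathbb G$ with $g^{(k)}(t\pm)=\operatorname{ess\,lim}_{s\to t\pm}\frac{g^{(k-1)}(s)-g^{(k-1)}(t\pm)}{s-t}$ for all $t\in I$ ($g^{(0)}=g$), with the norms $\|g\|_k=\max_{0\le i\le k}\|g^{(i)}\|_{L_\infty}$, $k\in\mathbf N_0$. $\mathcal R$ is the space of $\varphi\in\mathbb G^\infty$ with compact support in $I$, with the locally convex inductive limit topology of the countably normed spaces $\{\varphi\in\mathbb G^\infty:\varphi=0\text{ outside }J\}$ (norms $\|\cdot\|_k$), $J$ running over bounded subintervals with $\bar J\subset I$. $\mathcal R'$ is the space of continuous linear functionals $\mathcal R\to\mathbf C$ with the weak* topology. $\mathcal D$ is the classical space of compactly supported infinitely differentiable test functions on $I$ (with its usual topology), and $\mathcal D'$ the classical space of distributions on $I$ with the weak* topology. *)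

theory Defs
  imports "HOL-Analysis.Analysis" "HOL-Probability.Essential_Supremum"
begin

section \<open>Locally convex topologies on spaces of functions\<close>

text \<open>
  The spaces below are complex vector spaces of functions \<open>'x \<Rightarrow> complex\<close> under the pointwise
  operations.  The topologies need not be Hausdorff, because functions that agree almost everywhere
  are kept as distinct representatives of one element (see \<open>alg_G\<close> below).
\<close>

definition countably_normed_topology ::
    "('x \<Rightarrow> complex) set \<Rightarrow> (nat \<Rightarrow> ('x \<Rightarrow> complex) \<Rightarrow> real) \<Rightarrow> ('x \<Rightarrow> complex) topology" where
  "countably_normed_topology V p = topology_generated_by
     {{g \<in> V. p k (\<lambda>x. g x - f x) < e} | f k e. f \<in> V \<and> e > 0}"

definition locally_convex_topology_on ::
    "('x \<Rightarrow> complex) set \<Rightarrow> ('x \<Rightarrow> complex) topology \<Rightarrow> bool" where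
  "locally_convex_topology_on V X \<longleftrightarrow>
     topspace X = V \<and>
     continuous_map (prod_topology X X) X (\<lambda>(f, g) x. f x + g x) \<and>
     continuous_map (prod_topology euclidean X) X (\<lambda>(c, f) x. c * f x) \<and>
     (\<forall>U. openin X U \<and> (\<lambda>x. 0) \<in> U \<longrightarrow>
        (\<exists>W. openin X W \<and> (\<lambda>x. 0) \<in> W \<and> W \<subseteq> U \<and>
           (\<forall>f\<in>W. \<forall>g\<in>W. \<forall>u\<in>{0..1}.
              (\<lambda>x. of_real (1 - u) * f x + of_real u * g x) \<in> W)))"

text \<open>
  The finest locally convex topology on \<open>V\<close> for which the inclusions of all the spaces in \<open>S\<close> are
  continuous.  It is written as the supremum of all such topologies, which is again one of them.
\<close>

definition lc_inductive_limit ::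
    "('x \<Rightarrow> complex) set \<Rightarrow> ('x \<Rightarrow> complex) topology set \<Rightarrow> ('x \<Rightarrow> complex) topology" where
  "lc_inductive_limit V S = topology_generated_by
     {U. \<exists>X. locally_convex_topology_on V X \<and> (\<forall>Y\<in>S. continuous_map Y X (\<lambda>f. f)) \<and> openin X U}"

text \<open>
  Functionals on \<open>V\<close> take the value \<open>undefined\<close> off \<open>V\<close>, so that equality of functionals is
  equality on \<open>V\<close>.
\<close>

definition continuous_dual ::
    "('x \<Rightarrow> complex) set \<Rightarrow> ('x \<Rightarrow> complex) topology \<Rightarrow> (('x \<Rightarrow> complex) \<Rightarrow> complex) set" where
  "continuous_dual V X = {F \<in> extensional V.
     (\<forall>f\<in>V. \<forall>g\<in>V. F (\<lambda>x. f x + g x) = F f + F g) \<and>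
     (\<forall>c. \<forall>f\<in>V. F (\<lambda>x. c * f x) = c * F f) \<and>
     continuous_map X euclidean F}"


section \<open>Functions with one-sided essential limits\<close>

text \<open>
  A property holds eventually with respect to \<open>ess_at_right t\<close> iff for some \<open>\<delta> > 0\<close> it holds for
  almost every \<open>s \<in> {t<..<t + \<delta>}\<close>; convergence along this filter is the essential limit at \<open>t+\<close>.
\<close>

definition ess_at_right :: "real \<Rightarrow> real filter" where
  "ess_at_right t = inf (at_right t) (ae_filter lebesgue)"

definition ess_at_left :: "real \<Rightarrow> real filter" where
  "ess_at_left t = inf (at_left t) (ae_filter lebesgue)"

text \<open>
  Elements of the algebra on \<open>I\<close> are represented by functions on the whole line.  Two of them
  represent the same element iff they agree almost everywhere on \<open>I\<close>; values off \<open>I\<close> are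
  irrelevant.
\<close>

definition ae_eq_on :: "real set \<Rightarrow> (real \<Rightarrow> complex) \<Rightarrow> (real \<Rightarrow> complex) \<Rightarrow> bool" where
  "ae_eq_on I f g \<longleftrightarrow> (AE x in lebesgue_on I. f x = g x)"

definition alg_G :: "real set \<Rightarrow> (real \<Rightarrow> complex) set" where
  "alg_G I = {g.
     g \<in> borel_measurable (lebesgue_on I) \<and>
     (\<exists>C. AE x in lebesgue_on I. norm (g x) \<le> C) \<and>
     (\<forall>t\<in>I. (\<exists>l. (g \<longlongrightarrow> l) (ess_at_right t)) \<and> (\<exists>l. (g \<longlongrightarrow> l) (ess_at_left t)))}"

definition is_G_deriv :: "real set \<Rightarrow> (real \<Rightarrow> complex) \<Rightarrow> (real \<Rightarrow> complex) \<Rightarrow> bool" where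
  "is_G_deriv I g h \<longleftrightarrow> h \<in> alg_G I \<and>
     (\<forall>t\<in>I.
        ((\<lambda>s. (g s - Lim (ess_at_right t) g) / of_real (s - t)) \<longlongrightarrow> Lim (ess_at_right t) h)
          (ess_at_right t) \<and>
        ((\<lambda>s. (g s - Lim (ess_at_left t) g) / of_real (s - t)) \<longlongrightarrow> Lim (ess_at_left t) h)
          (ess_at_left t))"

text \<open>
  If it exists, the next derivative is unique up to equality almost everywhere on \<open>I\<close>, since an
  element of \<open>alg_G I\<close> is determined up to null sets by its one-sided essential limits.
\<close>

primrec G_deriv :: "real set \<Rightarrow> nat \<Rightarrow> (real \<Rightarrow> complex) \<Rightarrow> real \<Rightarrow> complex" where
  "G_deriv I 0 g = g"
| "G_deriv I (Suc k) g = (SOME h. is_G_deriv I (G_deriv I k g) h)"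

definition alg_G_inf :: "real set \<Rightarrow> (real \<Rightarrow> complex) set" where
  "alg_G_inf I = {g \<in> alg_G I. \<forall>k. \<exists>h. is_G_deriv I (G_deriv I k g) h}"

definition Linf_norm :: "real set \<Rightarrow> (real \<Rightarrow> complex) \<Rightarrow> real" where
  "Linf_norm I g = real_of_ereal (esssup (lebesgue_on I) (\<lambda>x. ereal (norm (g x))))"

definition G_norm :: "real set \<Rightarrow> nat \<Rightarrow> (real \<Rightarrow> complex) \<Rightarrow> real" where
  "G_norm I k g = Max ((\<lambda>i. Linf_norm I (G_deriv I i g)) ` {..k})"


section \<open>The space of test functions with one-sided limits, and its dual\<close>

definition space_R :: "real set \<Rightarrow> (real \<Rightarrow> complex) set" where
  "space_R I = {g \<in> alg_G_inf I.
     \<exists>K. compact K \<and> K \<subseteq> I \<and> (AE x in lebesgue_on I. x \<notin> K \<longrightarrow> g x = 0)}"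

definition space_R_step :: "real set \<Rightarrow> real set \<Rightarrow> (real \<Rightarrow> complex) set" where
  "space_R_step I J = {g \<in> alg_G_inf I. AE x in lebesgue_on I. x \<notin> J \<longrightarrow> g x = 0}"

definition topology_R :: "real set \<Rightarrow> (real \<Rightarrow> complex) topology" where
  "topology_R I = lc_inductive_limit (space_R I)
     {countably_normed_topology (space_R_step I J) (G_norm I) | J.
        is_interval J \<and> bounded J \<and> closure J \<subseteq> I}"

definition dual_R :: "real set \<Rightarrow> ((real \<Rightarrow> complex) \<Rightarrow> complex) set" where
  "dual_R I = {F \<in> continuous_dual (space_R I) (topology_R I).
     \<forall>f\<in>space_R I. \<forall>g\<in>space_R I. ae_eq_on I f g \<longrightarrow> F f = F g}"


section \<open>Classical test functions and distributions\<close>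

definition nth_deriv :: "nat \<Rightarrow> (real \<Rightarrow> complex) \<Rightarrow> real \<Rightarrow> complex" where
  "nth_deriv k = (\<lambda>f x. vector_derivative f (at x)) ^^ k"

text \<open>Test functions on \<open>I\<close> are extended by zero to the whole line.\<close>

definition space_D_step :: "real set \<Rightarrow> (real \<Rightarrow> complex) set" where
  "space_D_step K =
     {f. (\<forall>k x. nth_deriv k f differentiable (at x)) \<and> (\<forall>x. x \<notin> K \<longrightarrow> f x = 0)}"

definition space_D :: "real set \<Rightarrow> (real \<Rightarrow> complex) set" where
  "space_D I = (\<Union>K\<in>{K. compact K \<and> K \<subseteq> I}. space_D_step K)"

definition D_norm :: "nat \<Rightarrow> (real \<Rightarrow> complex) \<Rightarrow> real" where
  "D_norm k f = Max ((\<lambda>i. SUP x. norm (nth_deriv i f x)) ` {..k})"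

definition topology_D :: "real set \<Rightarrow> (real \<Rightarrow> complex) topology" where
  "topology_D I = lc_inductive_limit (space_D I)
     {countably_normed_topology (space_D_step K) D_norm | K. compact K \<and> K \<subseteq> I}"

definition dual_D :: "real set \<Rightarrow> ((real \<Rightarrow> complex) \<Rightarrow> complex) set" where
  "dual_D I = continuous_dual (space_D I) (topology_D I)"

definition restriction_op ::
    "real set \<Rightarrow> ((real \<Rightarrow> complex) \<Rightarrow> complex) \<Rightarrow> (real \<Rightarrow> complex) \<Rightarrow> complex" where
  "restriction_op I F = restrict F (space_D I)"

end

theory Submission
  imports Defs "HOL-Library.Function_Algebras"
begin

text \<open>
  A linear functional on either inductive limit is continuous iff on every step it is bounded by a
  constant times one of the norms.  For a test function in \<open>\<D>\<close> the generalized derivatives agree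
  almost everywhere with the classical ones, so the inclusion of \<open>\<D>\<close> into \<open>\<R>\<close> is continuous and
  restrictions of functionals in the dual of \<open>\<R>\<close> are distributions.

  Conversely let \<open>T\<close> be a distribution and let \<open>\<eta> n\<close> be a locally finite smooth partition of unity
  on \<open>I\<close>.  Each \<open>T (\<eta> n * f)\<close> is bounded by a constant times the maximum of finitely many
  derivatives of \<open>f\<close> over an open set \<open>A n\<close>, where the \<open>A n\<close> eventually leave every compact subset
  of \<open>I\<close>.  Hence \<open>T\<close> is dominated by \<open>p f = (\<Sum>n. c n * q n f)\<close>, where \<open>q n\<close> is the essential
  supremum norm of order \<open>k n\<close> over \<open>A n\<close>.  The seminorm \<open>p\<close> also makes sense on \<open>\<R>\<close>, where on every step
  it is a finite sum bounded by one of the norms, so a Hahn-Banach extension of \<open>T\<close> dominated by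
  \<open>p\<close> is continuous.  It respects equality almost everywhere because \<open>p\<close> does.
\<close>


section \<open>The Hahn-Banach theorem\<close>

text \<open>The obstacle is that the topology which \<D> inherits from \<R> might be coarser than
  its own inductive limit topology, so continuity of \<open>T\<close> on \<D> does not by itself
  allow an extension. Extending \<open>T\<close> separately on each step would not do either: the
  extensions need not fit together, and the order of the norm controlling \<open>T\<close> may grow
  with the support. A single seminorm on all of \<R> settles both points, and the partition of unity
  is what glues the local estimates, each of its own order \<open>k n\<close>, into it. Cutoffs
  multiply only smooth functions. On \<R> the localisation is done by restricting the essential
  supremum to \<open>A n\<close>, so a product rule is needed for classical derivatives only. The
  \<open>A n\<close> have to be open for two reasons: vanishing almost everywhere on an open set
  passes to the generalized derivatives there, and a continuous function is bounded at every point
  of an open set by its essential supremum over that set. The criterion for continuity on an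
  inductive limit rests on one test topology, the initial topology of the functional itself, which
  is locally convex.\<close>

instantiation "fun" :: (type, real_vector) real_vector
begin

definition scaleR_fun_def: "r *\<^sub>R f = (\<lambda>x. r *\<^sub>R f x)"

instance
  by standard (auto simp: scaleR_fun_def plus_fun_def scaleR_add_right scaleR_add_left)

end

text \<open>Zorn's lemma is applied to graphs: a partial extension is a subspace of the product with
  the reals that contains the graph of \<open>T\<close> and lies below \<open>p\<close>. Unions of
  chains of such subspaces are again of this kind, and a maximal one has full domain by the
  one-dimensional extension step.\<close>

lemma Hahn_Banach:
  fixes V W :: "'v::real_vector set" and p T :: "'v \<Rightarrow> real"
  assumes V: "subspace V" and W: "subspace W" and WV: "W \<subseteq> V"
    and p_add: "\<And>f g. f \<in> V \<Longrightarrow> g \<in> V \<Longrightarrow> p (f + g) \<le> p f + p g"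
    and p_scale: "\<And>t f. t \<ge> 0 \<Longrightarrow> f \<in> V \<Longrightarrow> p (t *\<^sub>R f) = t * p f"
    and T_add: "\<And>f g. f \<in> W \<Longrightarrow> g \<in> W \<Longrightarrow> T (f + g) = T f + T g"
    and T_scale: "\<And>t f. f \<in> W \<Longrightarrow> T (t *\<^sub>R f) = t * T f"
    and T_le: "\<And>f. f \<in> W \<Longrightarrow> T f \<le> p f"
  obtains F where "\<And>f g. f \<in> V \<Longrightarrow> g \<in> V \<Longrightarrow> F (f + g) = F f + F g"
    "\<And>t f. f \<in> V \<Longrightarrow> F (t *\<^sub>R f) = t * F f"
    "\<And>f. f \<in> V \<Longrightarrow> F f \<le> p f" "\<And>f. f \<in> W \<Longrightarrow> F f = T f"
proof -
  define G where "G = (\<lambda>f. (f, T f)) ` W"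
  \<comment> \<open>Single-valuedness is not demanded. It follows from domination: if
    \<open>(0, r)\<close> lies in such a subspace, so does \<open>(0, - r)\<close>, and both
    \<open>r\<close> and \<open>- r\<close> are at most \<open>p 0 = 0\<close>.\<close>
  define \<H> where "\<H> = {H :: ('v \<times> real) set. subspace H \<and> G \<subseteq> H \<and> (\<forall>(f, r) \<in> H. f \<in> V \<and> r \<le> p f)}"
  have p0: "p 0 = 0" using p_scale[of 0 0] subspace_0[OF V] by simp
  have "subspace G"
    unfolding subspace_def G_def
  proof (intro conjI ballI allI)
    show "0 \<in> (\<lambda>f. (f, T f)) ` W"
      using subspace_0[OF W] T_scale[of 0 0] by (auto simp: zero_prod_def image_iff)
    show "x + y \<in> (\<lambda>f. (f, T f)) ` W" if "x \<in> (\<lambda>f. (f, T f)) ` W" "y \<in> (\<lambda>f. (f, T f)) ` W" for x y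
      using that T_add subspace_add[OF W] by (auto simp: image_iff)
    show "t *\<^sub>R x \<in> (\<lambda>f. (f, T f)) ` W" if "x \<in> (\<lambda>f. (f, T f)) ` W" for x t
      using that T_scale subspace_scale[OF W] by (auto simp: image_iff)
  qed
  then have "G \<in> \<H>" using WV T_le by (auto simp: \<H>_def G_def)
  have "\<exists>M\<in>\<H>. \<forall>X\<in>\<H>. M \<subseteq> X \<longrightarrow> X = M"
  proof (rule subset_Zorn_nonempty)
    show "\<H> \<noteq> {}" using \<open>G \<in> \<H>\<close> by auto
    fix \<C> assume ne: "\<C> \<noteq> {}" and ch: "subset.chain \<H> \<C>"
    then have sub: "\<C> \<subseteq> \<H>" by (simp add: subset_chain_def)
    have "subspace (\<Union>\<C>)"
      unfolding subspace_def
    proof (intro conjI ballI allI)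
      show "0 \<in> \<Union>\<C>" using ne sub subspace_0 by (auto simp: \<H>_def)
      fix x assume x: "x \<in> \<Union>\<C>"
      then show "t *\<^sub>R x \<in> \<Union>\<C>" for t
        using sub subspace_scale unfolding \<H>_def by blast
      fix y assume "y \<in> \<Union>\<C>"
      with x obtain X Y where "X \<in> \<C>" "Y \<in> \<C>" "x \<in> X" "y \<in> Y" by auto
      with ch obtain Z where "Z \<in> \<C>" "x \<in> Z" "y \<in> Z"
        unfolding subset_chain_def by blast
      then show "x + y \<in> \<Union>\<C>"
        using sub subspace_add unfolding \<H>_def by blast
    qed
    then show "\<Union>\<C> \<in> \<H>" using ne sub by (fastforce simp: \<H>_def)
  qed
  then obtain M where M: "M \<in> \<H>" and max: "\<And>X. X \<in> \<H> \<Longrightarrow> M \<subseteq> X \<Longrightarrow> X = M" by blast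
  have sM: "subspace M" and GM: "G \<subseteq> M" and MV: "\<And>f r. (f, r) \<in> M \<Longrightarrow> f \<in> V"
    and Mp: "\<And>f r. (f, r) \<in> M \<Longrightarrow> r \<le> p f"
    using M by (auto simp: \<H>_def)
  have uniq: "r = s" if "(f, r) \<in> M" "(f, s) \<in> M" for f r s
    using Mp[of 0 "r - s"] Mp[of 0 "s - r"] subspace_diff[OF sM that] subspace_diff[OF sM that(2,1)] p0
    by simp
  have total: "\<exists>r. (f, r) \<in> M" if f: "f \<in> V" for f
  proof (rule ccontr)
    assume nf: "\<nexists>r. (f, r) \<in> M"
    \<comment> \<open>A value \<open>c\<close> at \<open>f\<close> is admissible iff it lies above
      every \<open>r - p (g - f)\<close> and below every \<open>p (h + f) - s\<close>. By
      \<open>sep\<close> each lower bound is at most each upper bound, so the supremum of the lower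
      ones will do.\<close>
    define L where "L = (\<lambda>(g, r). r - p (g - f)) ` M"
    have sep: "r - p (g - f) \<le> p (h + f) - s" if "(g, r) \<in> M" "(h, s) \<in> M" for g r h s
    proof -
      have "r + s \<le> p (g + h)" using Mp[of "g + h" "r + s"] subspace_add[OF sM that] by simp
      also have "g + h = (g - f) + (h + f)" by simp
      also have "p \<dots> \<le> p (g - f) + p (h + f)"
        using that MV f V by (intro p_add subspace_diff subspace_add) auto
      finally show ?thesis by simp
    qed
    have M0: "(0, 0) \<in> M" using subspace_0[OF sM] by (simp add: zero_prod_def)
    define c where "c = Sup L"
    have "bdd_above L" using sep[OF _ M0] by (fastforce simp: L_def bdd_above_def)
    then have c1: "r - p (g - f) \<le> c" if "(g, r) \<in> M" for g r
      unfolding c_def using that by (intro cSup_upper) (force simp: L_def image_iff)+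
    have c2: "c \<le> p (h + f) - s" if "(h, s) \<in> M" for h s
      unfolding c_def using M0 sep that by (intro cSup_least) (auto simp: L_def)
    define N where "N = {m + x | m x. m \<in> M \<and> x \<in> span {(f, c)}}"
    have "subspace N" unfolding N_def using sM by (intro subspace_sums subspace_span)
    moreover have MN: "M \<subseteq> N"
    proof
      fix m assume "m \<in> M"
      moreover have "m = m + 0" by simp
      ultimately show "m \<in> N" unfolding N_def using span_zero by blast
    qed
    \<comment> \<open>Dividing by the absolute value of \<open>t\<close> reduces to the coefficients
      1 and -1, which are the cases covered by \<open>c2\<close> and \<open>c1\<close>.\<close>
    moreover have "g + t *\<^sub>R f \<in> V \<and> r + t * c \<le> p (g + t *\<^sub>R f)" if "(g, r) \<in> M" for g r t
    proof
      have g: "g \<in> V" using MV that .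
      then show "g + t *\<^sub>R f \<in> V" using f V by (intro subspace_add subspace_scale) auto
      have sc: "((1 / u) *\<^sub>R g, r / u) \<in> M" if "u > 0" for u
        using subspace_scale[OF sM \<open>(g, r) \<in> M\<close>, of "1 / u"] by simp
      consider "t = 0" | "t > 0" | "t < 0" by linarith
      then show "r + t * c \<le> p (g + t *\<^sub>R f)"
      proof cases
        case 1 then show ?thesis using Mp that by simp
      next
        case 2
        have "r + t * c \<le> t * p ((1 / t) *\<^sub>R g + f)"
          using c2[OF sc[OF 2]] 2 by (simp add: field_simps)
        also have "\<dots> = p (t *\<^sub>R ((1 / t) *\<^sub>R g + f))"
          using 2 f g V by (intro p_scale[symmetric] subspace_add subspace_scale) auto
        finally show ?thesis using 2 by (simp add: scaleR_add_right)
      next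
        case 3
        then have "r + t * c \<le> (- t) * p ((1 / - t) *\<^sub>R g - f)"
          using c1[OF sc[of "- t"]] by (simp add: field_simps)
        also have "\<dots> = p ((- t) *\<^sub>R ((1 / - t) *\<^sub>R g - f))"
          using 3 f g V by (intro p_scale[symmetric] subspace_diff subspace_scale) auto
        finally show ?thesis using 3 by (simp add: scaleR_diff_right)
      qed
    qed
    ultimately have "N \<in> \<H>"
      using GM by (auto simp: \<H>_def N_def span_singleton)
    then have "N = M" using max MN by blast
    moreover have "(f, c) \<in> N"
      unfolding N_def using subspace_0[OF sM] span_base[of "(f, c)" "{(f, c)}"]
      by (smt (verit, best) CollectI add_0 insertI1)
    ultimately show False using nf by blast
  qed
  define F where "F f = (THE r. (f, r) \<in> M)" for f
  have FI: "F f = r" if "(f, r) \<in> M" for f r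
    unfolding F_def using that uniq by blast
  have FM: "(f, F f) \<in> M" if "f \<in> V" for f
    using total[OF that] FI by auto
  show thesis
  proof
    show "F (f + g) = F f + F g" if "f \<in> V" "g \<in> V" for f g
      using subspace_add[OF sM FM[OF that(1)] FM[OF that(2)]] by (intro FI) simp
    show "F (t *\<^sub>R f) = t * F f" if "f \<in> V" for f t
      using subspace_scale[OF sM FM[OF that], of t] by (intro FI) simp
    show "F f \<le> p f" if "f \<in> V" for f using Mp FM that by blast
    show "F f = T f" if "f \<in> W" for f using that GM by (intro FI) (auto simp: G_def)
  qed
qed

section \<open>Complex subspaces, linear functionals and seminorms of functions\<close>

text \<open>Spelled out with pointwise operations and complex scalars, as in the definitions of the
  topologies and the duals. This and the next two notions are relative to a set, since all spaces
  here are proper subsets of one function type.\<close>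

definition fun_subspace :: "('x \<Rightarrow> complex) set \<Rightarrow> bool" where
  "fun_subspace V \<longleftrightarrow> (\<lambda>x. 0) \<in> V \<and> (\<forall>f\<in>V. \<forall>g\<in>V. (\<lambda>x. f x + g x) \<in> V) \<and>
     (\<forall>c. \<forall>f\<in>V. (\<lambda>x. c * f x) \<in> V)"

definition fun_linear_on :: "('x \<Rightarrow> complex) set \<Rightarrow> (('x \<Rightarrow> complex) \<Rightarrow> complex) \<Rightarrow> bool" where
  "fun_linear_on V F \<longleftrightarrow> (\<forall>f\<in>V. \<forall>g\<in>V. F (\<lambda>x. f x + g x) = F f + F g) \<and>
     (\<forall>c. \<forall>f\<in>V. F (\<lambda>x. c * f x) = c * F f)"

definition fun_seminorm_on :: "('x \<Rightarrow> complex) set \<Rightarrow> (('x \<Rightarrow> complex) \<Rightarrow> real) \<Rightarrow> bool" where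
  "fun_seminorm_on V p \<longleftrightarrow> (\<forall>f\<in>V. 0 \<le> p f) \<and> (\<forall>f\<in>V. \<forall>g\<in>V. p (\<lambda>x. f x + g x) \<le> p f + p g) \<and>
     (\<forall>c. \<forall>f\<in>V. p (\<lambda>x. c * f x) = cmod c * p f)"

lemma fun_subspace_zero: "fun_subspace V \<Longrightarrow> (\<lambda>x. 0) \<in> V"
  and fun_subspace_add: "fun_subspace V \<Longrightarrow> f \<in> V \<Longrightarrow> g \<in> V \<Longrightarrow> (\<lambda>x. f x + g x) \<in> V"
  and fun_subspace_scale: "fun_subspace V \<Longrightarrow> f \<in> V \<Longrightarrow> (\<lambda>x. c * f x) \<in> V"
  by (auto simp: fun_subspace_def)

lemma fun_subspace_diff:
  assumes "fun_subspace V" "f \<in> V" "g \<in> V" shows "(\<lambda>x. f x - g x) \<in> V"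
  using fun_subspace_add[OF assms(1,2) fun_subspace_scale[OF assms(1,3), of "-1"]] by simp

lemma fun_subspace_imp_subspace: "fun_subspace V \<Longrightarrow> subspace V"
  using fun_subspace_scale[of V _ "complex_of_real _"]
  by (auto simp: subspace_def fun_subspace_def zero_fun_def plus_fun_def scaleR_fun_def scaleR_conv_of_real)

lemma fun_linear_on_add: "fun_linear_on V F \<Longrightarrow> f \<in> V \<Longrightarrow> g \<in> V \<Longrightarrow> F (\<lambda>x. f x + g x) = F f + F g"
  and fun_linear_on_scale: "fun_linear_on V F \<Longrightarrow> f \<in> V \<Longrightarrow> F (\<lambda>x. c * f x) = c * F f"
  by (auto simp: fun_linear_on_def)

lemma fun_linear_on_diff:
  assumes "fun_linear_on V F" "fun_subspace V" "f \<in> V" "g \<in> V"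
  shows "F (\<lambda>x. f x - g x) = F f - F g"
  using fun_linear_on_add[OF assms(1,3) fun_subspace_scale[OF assms(2,4), of "-1"]]
    fun_linear_on_scale[OF assms(1,4), of "-1"] by simp

lemma fun_linear_on_zero: "fun_linear_on V F \<Longrightarrow> fun_subspace V \<Longrightarrow> F (\<lambda>x. 0) = 0"
  using fun_linear_on_scale[of V F "\<lambda>x. 0" 0] by (simp add: fun_subspace_zero)

lemma fun_linear_on_subset: "fun_linear_on V F \<Longrightarrow> W \<subseteq> V \<Longrightarrow> fun_linear_on W F"
  by (auto simp: fun_linear_on_def subset_iff)

lemma fun_linear_on_sum:
  assumes "fun_linear_on V F" "fun_subspace V" "finite A" "\<And>n. n \<in> A \<Longrightarrow> f n \<in> V"
  shows "(\<lambda>x. \<Sum>n\<in>A. f n x) \<in> V \<and> F (\<lambda>x. \<Sum>n\<in>A. f n x) = (\<Sum>n\<in>A. F (f n))"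
  using assms(3,4)
proof (induction A rule: finite_induct)
  case empty
  then show ?case using fun_linear_on_zero assms(1,2) fun_subspace_zero by auto
next
  case (insert n A)
  then show ?case
    using fun_linear_on_add[OF assms(1)] fun_subspace_add[OF assms(2)] by auto
qed

lemma fun_seminorm_on_nonneg: "fun_seminorm_on V p \<Longrightarrow> f \<in> V \<Longrightarrow> 0 \<le> p f"
  and fun_seminorm_on_add: "fun_seminorm_on V p \<Longrightarrow> f \<in> V \<Longrightarrow> g \<in> V \<Longrightarrow> p (\<lambda>x. f x + g x) \<le> p f + p g"
  and fun_seminorm_on_scale: "fun_seminorm_on V p \<Longrightarrow> f \<in> V \<Longrightarrow> p (\<lambda>x. c * f x) = cmod c * p f"
  by (auto simp: fun_seminorm_on_def)

lemma fun_seminorm_on_zero: "fun_seminorm_on V p \<Longrightarrow> f \<in> V \<Longrightarrow> p (\<lambda>x. 0) = 0"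
  using fun_seminorm_on_scale[of V p f 0] by simp

lemma fun_seminorm_on_subset: "fun_seminorm_on V p \<Longrightarrow> W \<subseteq> V \<Longrightarrow> fun_seminorm_on W p"
  by (auto simp: fun_seminorm_on_def subset_iff)

text \<open>The real part of \<open>T\<close> is extended by the real theorem, and the extension is
  completed to a complex linear functional. A rotation turns the one-sided real bound into a bound
  on the modulus.\<close>

lemma complex_Hahn_Banach:
  assumes V: "fun_subspace V" and W: "fun_subspace W" and WV: "W \<subseteq> V"
    and p: "fun_seminorm_on V p" and T: "fun_linear_on W T"
    and T_le: "\<And>f. f \<in> W \<Longrightarrow> cmod (T f) \<le> p f"
  obtains F where "fun_linear_on V F" "\<And>f. f \<in> V \<Longrightarrow> cmod (F f) \<le> p f" "\<And>f. f \<in> W \<Longrightarrow> F f = T f"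
proof -
  obtain R where R_add: "\<And>f g. f \<in> V \<Longrightarrow> g \<in> V \<Longrightarrow> R (f + g) = R f + R g"
    and R_scale: "\<And>t f. f \<in> V \<Longrightarrow> R (t *\<^sub>R f) = t * R f"
    and R_le: "\<And>f. f \<in> V \<Longrightarrow> R f \<le> p f" and R_eq: "\<And>f. f \<in> W \<Longrightarrow> R f = Re (T f)"
  proof (rule Hahn_Banach[of V W p "\<lambda>f. Re (T f)"])
    show "subspace V" "subspace W" using V W fun_subspace_imp_subspace by auto
    show "p (f + g) \<le> p f + p g" if "f \<in> V" "g \<in> V" for f g
      using fun_seminorm_on_add[OF p that] by (simp add: plus_fun_def)
    show "p (t *\<^sub>R f) = t * p f" if "0 \<le> t" "f \<in> V" for t f
      using fun_seminorm_on_scale[OF p that(2), of "of_real t"] that(1)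
      by (simp add: scaleR_fun_def scaleR_conv_of_real)
    show "Re (T (f + g)) = Re (T f) + Re (T g)" if "f \<in> W" "g \<in> W" for f g
      using fun_linear_on_add[OF T that] by (simp add: plus_fun_def)
    show "Re (T (t *\<^sub>R f)) = t * Re (T f)" if "f \<in> W" for t f
      using fun_linear_on_scale[OF T that, of "of_real t"] by (simp add: scaleR_fun_def scaleR_conv_of_real)
    show "Re (T f) \<le> p f" if "f \<in> W" for f
      using T_le[OF that] complex_Re_le_cmod[of "T f"] by linarith
  qed (use WV in auto)
  \<comment> \<open>Forced by complex linearity: the real part of \<open>\<i> * F f\<close> is minus
    the imaginary part of \<open>F f\<close>.\<close>
  define F where "F f = Complex (R f) (- R (\<lambda>x. \<i> * f x))" for f
  have F_add: "F (\<lambda>x. f x + g x) = F f + F g" if "f \<in> V" "g \<in> V" for f g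
    using R_add[OF that] R_add[OF fun_subspace_scale[OF V that(1), of \<i>] fun_subspace_scale[OF V that(2), of \<i>]]
    by (simp add: F_def plus_fun_def complex_eq_iff distrib_left)
  have F_real: "F (\<lambda>x. of_real t * f x) = of_real t * F f" if "f \<in> V" for f t
    using R_scale[OF that, of t] R_scale[OF fun_subspace_scale[OF V that, of \<i>], of t]
    by (simp add: F_def scaleR_fun_def scaleR_conv_of_real complex_eq_iff mult.left_commute)
  have F_i: "F (\<lambda>x. \<i> * f x) = \<i> * F f" if "f \<in> V" for f
    using R_scale[OF that, of "-1"]
    by (simp add: F_def scaleR_fun_def complex_eq_iff mult.assoc[symmetric])
  have F_scale: "F (\<lambda>x. c * f x) = c * F f" if f: "f \<in> V" for c f
  proof -
    have "F (\<lambda>x. c * f x) = F (\<lambda>x. of_real (Re c) * f x + of_real (Im c) * (\<i> * f x))"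
      by (rule arg_cong[where f = F], rule ext, subst (1) complex_eq[of c]) (simp add: algebra_simps)
    also have "\<dots> = of_real (Re c) * F f + of_real (Im c) * (\<i> * F f)"
      using f V by (simp add: F_add F_real F_i fun_subspace_scale)
    also have "\<dots> = c * F f"
      by (subst (3) complex_eq[of c]) (simp add: algebra_simps)
    finally show ?thesis .
  qed
  show thesis
  proof
    show "fun_linear_on V F" using F_add F_scale by (auto simp: fun_linear_on_def)
    show "F f = T f" if "f \<in> W" for f
      using R_eq[OF that] R_eq[OF fun_subspace_scale[OF W that, of \<i>]] fun_linear_on_scale[OF T that, of \<i>]
      by (simp add: F_def complex_eq_iff)
    show "cmod (F f) \<le> p f" if f: "f \<in> V" for f
    proof (cases "F f = 0")
      case True then show ?thesis using fun_seminorm_on_nonneg[OF p f] by simp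
    next
      case False
      \<comment> \<open>The unimodular factor that turns \<open>F f\<close> into a nonnegative real,
        so that its modulus is a value of \<open>R\<close>.\<close>
      define c where "c = cnj (F f) / of_real (cmod (F f))"
      have c: "cmod c = 1" using False by (simp add: c_def norm_divide)
      have "c * F f = of_real (cmod (F f))"
        using False by (simp add: c_def complex_norm_square[symmetric] power2_eq_square mult.commute)
      then have "cmod (F f) = Re (F (\<lambda>x. c * f x))" by (simp add: F_scale[OF f])
      also have "\<dots> = R (\<lambda>x. c * f x)" by (simp add: F_def)
      also have "\<dots> \<le> p (\<lambda>x. c * f x)" using R_le fun_subspace_scale[OF V f] by blast
      also have "\<dots> = p f" by (simp add: fun_seminorm_on_scale[OF p f] c)
      finally show ?thesis .
    qed
  qed
qed

section \<open>Continuous functionals on inductive limits\<close>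

text \<open>The balls are given only as a subbasis. Since the norms increase with \<open>k\<close>,
  a finite intersection of balls around one point contains a ball for the largest index and the
  smallest radius.\<close>

lemma openin_countably_normedD:
  assumes V: "fun_subspace V" and p: "\<And>k. fun_seminorm_on V (p k)"
    and mono: "\<And>j k f. j \<le> k \<Longrightarrow> f \<in> V \<Longrightarrow> p j f \<le> p k f"
    and U: "openin (countably_normed_topology V p) U" and f: "f \<in> U"
  shows "\<exists>k e. e > 0 \<and> {g \<in> V. p k (\<lambda>x. g x - f x) < e} \<subseteq> U"
proof -
  have "generate_topology_on {{g \<in> V. p k (\<lambda>x. g x - h x) < e} | h k e. h \<in> V \<and> e > 0} U"
    using U by (simp add: countably_normed_topology_def openin_topology_generated_by)
  then show ?thesis using f
  proof (induction rule: generate_topology_on.induct)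
    case Empty then show ?case by simp
  next
    case (Int A B)
    obtain k e k' e' where *: "e > 0" "{g \<in> V. p k (\<lambda>x. g x - f x) < e} \<subseteq> A"
      "e' > 0" "{g \<in> V. p k' (\<lambda>x. g x - f x) < e'} \<subseteq> B"
      using Int by blast
    have fV: "f \<in> V"
    proof -
      have "A \<subseteq> V" using \<open>generate_topology_on _ A\<close>
        by (induction rule: generate_topology_on.induct) blast+
      then show ?thesis using Int.prems by blast
    qed
    have "{g \<in> V. p (max k k') (\<lambda>x. g x - f x) < min e e'} \<subseteq> A \<inter> B"
    proof
      fix g assume "g \<in> {g \<in> V. p (max k k') (\<lambda>x. g x - f x) < min e e'}"
      then have g: "g \<in> V" "p (max k k') (\<lambda>x. g x - f x) < e" "p (max k k') (\<lambda>x. g x - f x) < e'" by auto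
      then show "g \<in> A \<inter> B"
        using *(2,4) mono[of k "max k k'", OF _ fun_subspace_diff[OF V g(1) fV]]
          mono[of k' "max k k'", OF _ fun_subspace_diff[OF V g(1) fV]]
        by force
    qed
    then show ?case using *(1,3) by (intro exI[of _ "max k k'"] exI[of _ "min e e'"]) auto
  next
    case (UN K)
    then show ?case by (meson UnionE Union_upper subset_trans)
  next
    case (Basis S)
    then obtain h k e where S: "S = {g \<in> V. p k (\<lambda>x. g x - h x) < e}" "h \<in> V" "e > 0" by auto
    with Basis have f: "f \<in> V" "p k (\<lambda>x. f x - h x) < e" by auto
    have "{g \<in> V. p k (\<lambda>x. g x - f x) < e - p k (\<lambda>x. f x - h x)} \<subseteq> S"
    proof
      fix g assume g: "g \<in> {g \<in> V. p k (\<lambda>x. g x - f x) < e - p k (\<lambda>x. f x - h x)}"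
      then have gV: "g \<in> V" by simp
      have "p k (\<lambda>x. (g x - f x) + (f x - h x)) \<le> p k (\<lambda>x. g x - f x) + p k (\<lambda>x. f x - h x)"
        by (intro fun_seminorm_on_add[OF p] fun_subspace_diff V gV f(1) S(2))
      then have "p k (\<lambda>x. g x - h x) \<le> p k (\<lambda>x. g x - f x) + p k (\<lambda>x. f x - h x)" by simp
      then show "g \<in> S" using g S by auto
    qed
    then show ?case using f(2) by (intro exI[of _ k] exI[of _ "e - p k (\<lambda>x. f x - h x)"]) auto
  qed
qed

lemma topspace_countably_normed:
  assumes "fun_subspace V" "\<And>k. fun_seminorm_on V (p k)"
  shows "topspace (countably_normed_topology V p) = V"
proof -
  have "f \<in> {g \<in> V. p 0 (\<lambda>x. g x - f x) < 1}" if "f \<in> V" for f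
    using that fun_seminorm_on_zero[OF assms(2) that] by simp
  then have "V \<subseteq> topspace (countably_normed_topology V p)"
    unfolding countably_normed_topology_def topology_generated_by_topspace using zero_less_one by blast
  moreover have "topspace (countably_normed_topology V p) \<subseteq> V"
    unfolding countably_normed_topology_def topology_generated_by_topspace by blast
  ultimately show ?thesis by blast
qed

text \<open>The usual equivalence of continuity and boundedness; a neighbourhood of zero involves
  just one norm because the norms are increasing.\<close>

lemma continuous_map_countably_normed_iff:
  assumes V: "fun_subspace V" and p: "\<And>k. fun_seminorm_on V (p k)"
    and mono: "\<And>j k f. j \<le> k \<Longrightarrow> f \<in> V \<Longrightarrow> p j f \<le> p k f"
    and F: "fun_linear_on V F"
  shows "continuous_map (countably_normed_topology V p) euclidean F \<longleftrightarrow>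
    (\<exists>k C. \<forall>f\<in>V. cmod (F f) \<le> C * p k f)"
proof
  assume cont: "continuous_map (countably_normed_topology V p) euclidean F"
  have "openin (countably_normed_topology V p) {f \<in> V. F f \<in> ball 0 1}"
    using openin_continuous_map_preimage[OF cont, of "ball 0 1"] topspace_countably_normed[OF V p] by simp
  moreover have "(\<lambda>x. 0) \<in> {f \<in> V. F f \<in> ball 0 1}"
    using fun_linear_on_zero[OF F V] fun_subspace_zero[OF V] by simp
  ultimately obtain k e where e: "e > 0" and sub: "{g \<in> V. p k (\<lambda>x. g x - 0) < e} \<subseteq> {f \<in> V. F f \<in> ball 0 1}"
    using openin_countably_normedD[of V p, OF V p mono] by blast
  have "cmod (F f) \<le> (1 / e) * p k f" if f: "f \<in> V" for f
  proof (rule field_le_epsilon)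
    fix d :: real assume d: "d > 0"
    \<comment> \<open>\<open>p k\<close> is only a seminorm, so \<open>p k f\<close> may be 0 and
      cannot be divided by. The slack \<open>e * d\<close> keeps the denominator positive and the
      rescaled function strictly inside the ball.\<close>
    define t where "t = e / (p k f + e * d)"
    have pos: "p k f + e * d > 0" using fun_seminorm_on_nonneg[OF p f, of k] d e by (intro add_nonneg_pos) auto
    have t: "t > 0" using e pos by (simp add: t_def)
    have "p k (\<lambda>x. of_real t * f x) = t * p k f" using fun_seminorm_on_scale[OF p f] t by simp
    also have "\<dots> < e" using pos e d by (simp add: t_def field_simps)
    finally have "(\<lambda>x. of_real t * f x) \<in> {g \<in> V. p k (\<lambda>x. g x - 0) < e}"
      using fun_subspace_scale[OF V f] by simp
    then have "cmod (F (\<lambda>x. of_real t * f x)) < 1" using sub by auto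
    then have "t * cmod (F f) < 1" using fun_linear_on_scale[OF F f] t by (simp add: norm_mult)
    then show "cmod (F f) \<le> (1 / e) * p k f + d" using pos e by (simp add: t_def field_simps)
  qed
  then show "\<exists>k C. \<forall>f\<in>V. cmod (F f) \<le> C * p k f" by blast
next
  assume "\<exists>k C. \<forall>f\<in>V. cmod (F f) \<le> C * p k f"
  then obtain k C where C: "\<And>f. f \<in> V \<Longrightarrow> cmod (F f) \<le> C * p k f" by blast
  \<comment> \<open>\<open>C\<close> may be zero or negative, but the radius below is
    \<open>e / D\<close>.\<close>
  define D where "D = max C 1"
  have D: "D > 0" and CD: "cmod (F f) \<le> D * p k f" if "f \<in> V" for f
    using C[OF that] fun_seminorm_on_nonneg[OF p that, of k] mult_right_mono[of C D "p k f"] by (auto simp: D_def)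
  show "continuous_map (countably_normed_topology V p) euclidean F"
    unfolding continuous_map topspace_countably_normed[OF V p]
  proof (intro conjI allI impI)
    fix U :: "complex set" assume "openin euclidean U"
    then have U: "open U" by simp
    show "openin (countably_normed_topology V p) {f \<in> V. F f \<in> U}"
    proof (subst openin_subopen, intro ballI)
      fix f assume "f \<in> {f \<in> V. F f \<in> U}"
      then have f: "f \<in> V" "F f \<in> U" by auto
      then obtain e where e: "e > 0" "ball (F f) e \<subseteq> U" using U open_contains_ball by blast
      define B where "B = {g \<in> V. p k (\<lambda>x. g x - f x) < e / D}"
      have "openin (countably_normed_topology V p) B"
        unfolding countably_normed_topology_def B_def using f e D[OF f(1)]
        by (intro topology_generated_by_Basis) (auto intro!: exI[of _ f] exI[of _ k] exI[of _ "e / D"])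
      moreover have "f \<in> B" using f e D[OF f(1)] fun_seminorm_on_zero[OF p f(1)] by (simp add: B_def)
      moreover have "B \<subseteq> {f \<in> V. F f \<in> U}"
      proof
        fix g assume "g \<in> B"
        then have g: "g \<in> V" "p k (\<lambda>x. g x - f x) < e / D" by (auto simp: B_def)
        have "cmod (F g - F f) \<le> D * p k (\<lambda>x. g x - f x)"
          using CD[OF fun_subspace_diff[OF V g(1) f(1)]] fun_linear_on_diff[OF F V g(1) f(1)] by simp
        also have "\<dots> < e" using g(2) D[OF f(1)] by (simp add: field_simps)
        finally have "F g \<in> ball (F f) e" by (simp add: dist_norm norm_minus_commute)
        then show "g \<in> {f \<in> V. F f \<in> U}" using e g by auto
      qed
      ultimately show "\<exists>T. openin (countably_normed_topology V p) T \<and> f \<in> T \<and> T \<subseteq> {f \<in> V. F f \<in> U}" by blast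
    qed
  qed auto
qed

text \<open>The operations commute with \<open>F\<close>, and preimages of balls under a linear map
  are convex. This topology competes in the supremum that defines
  \<open>lc_inductive_limit\<close>.\<close>

lemma locally_convex_pullback:
  assumes V: "fun_subspace V" and F: "fun_linear_on V F"
  shows "locally_convex_topology_on V (pullback_topology V F euclidean)"
proof -
  let ?X = "pullback_topology V F euclidean"
  have top: "topspace ?X = V" by (simp add: topspace_pullback_topology)
  have cF: "continuous_map ?X euclidean F"
    using continuous_map_pullback[of euclidean euclidean id V F] by simp
  have add: "continuous_map (prod_topology ?X ?X) ?X (\<lambda>(f, g) x. f x + g x)"
  proof (rule continuous_map_pullback')
    have "continuous_map (prod_topology ?X ?X) euclidean (\<lambda>z. F (fst z) + F (snd z))"
      using continuous_map_compose[OF continuous_map_fst cF] continuous_map_compose[OF continuous_map_snd cF]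
      by (intro continuous_map_add) (auto simp: o_def)
    then show "continuous_map (prod_topology ?X ?X) euclidean (F \<circ> (\<lambda>(f, g) x. f x + g x))"
      by (rule continuous_map_eq) (auto simp: top fun_linear_on_add[OF F])
  qed (auto simp: top fun_subspace_add[OF V])
  have scale: "continuous_map (prod_topology euclidean ?X) ?X (\<lambda>(c, f) x. c * f x)"
  proof (rule continuous_map_pullback')
    have "continuous_map (prod_topology euclidean ?X) euclidean (\<lambda>z. (fst z :: complex, F (snd z)))"
      using continuous_map_compose[OF continuous_map_snd cF]
      unfolding prod_topology_euclidean[symmetric]
      by (intro continuous_map_pairedI) (auto simp: o_def intro: continuous_map_fst)
    moreover have "continuous_map euclidean euclidean (\<lambda>z. fst z * snd z :: complex)"
      by (auto intro!: continuous_intros)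
    ultimately have "continuous_map (prod_topology euclidean ?X) euclidean (\<lambda>z. fst z * F (snd z))"
      using continuous_map_compose[of _ euclidean "\<lambda>z. (fst z, F (snd z))" euclidean "\<lambda>z. fst z * snd z"]
      by (simp only: o_def fst_conv snd_conv)
    then show "continuous_map (prod_topology euclidean ?X) euclidean (F \<circ> (\<lambda>(c, f) x. c * f x))"
      by (rule continuous_map_eq) (auto simp: top fun_linear_on_scale[OF F])
  qed (auto simp: top fun_subspace_scale[OF V])
  have conv: "\<exists>W. openin ?X W \<and> (\<lambda>x. 0) \<in> W \<and> W \<subseteq> U \<and> (\<forall>f\<in>W. \<forall>g\<in>W. \<forall>u\<in>{0..1}.
      (\<lambda>x. of_real (1 - u) * f x + of_real u * g x) \<in> W)" if "openin ?X U" "(\<lambda>x. 0) \<in> U" for U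
  proof -
    obtain O' where O': "open O'" "U = F -` O' \<inter> V"
      using \<open>openin ?X U\<close> by (auto simp: openin_pullback_topology)
    then have "0 \<in> O'" using that(2) fun_linear_on_zero[OF F V] by auto
    then obtain e where e: "e > 0" "ball 0 e \<subseteq> O'" using O'(1) open_contains_ball by blast
    have "(\<lambda>x. of_real (1 - u) * f x + of_real u * g x) \<in> F -` ball 0 e \<inter> V"
      if f: "f \<in> F -` ball 0 e \<inter> V" and g: "g \<in> F -` ball 0 e \<inter> V" and u: "u \<in> {0..1}" for f g and u :: real
    proof -
      have "(1 - u) *\<^sub>R F f + u *\<^sub>R F g \<in> ball 0 e"
        using f g u by (intro convexD[OF convex_ball]) auto
      then show ?thesis
        using f g fun_subspace_scale[OF V] fun_linear_on_add[OF F] fun_linear_on_scale[OF F]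
        by (auto simp: fun_subspace_add[OF V] scaleR_conv_of_real)
    qed
    moreover have "openin ?X (F -` ball 0 e \<inter> V)" by (auto simp: openin_pullback_topology)
    ultimately show ?thesis
      using e O' fun_linear_on_zero[OF F V] fun_subspace_zero[OF V]
      by (intro exI[of _ "F -` ball 0 e \<inter> V"]) auto
  qed
  show ?thesis unfolding locally_convex_topology_on_def using top add scale conv by blast
qed

text \<open>If \<open>F\<close> is continuous on every step, its initial topology is one of the
  topologies in the supremum, so preimages under \<open>F\<close> are open in the limit. Conversely
  the inclusion of each step into the limit is continuous, because it is continuous into each of the
  competing topologies.\<close>

lemma continuous_map_lc_inductive_limit_iff:
  assumes V: "fun_subspace V" and F: "fun_linear_on V F" and S: "\<And>Y. Y \<in> S \<Longrightarrow> topspace Y \<subseteq> V"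
  shows "continuous_map (lc_inductive_limit V S) euclidean F \<longleftrightarrow> (\<forall>Y\<in>S. continuous_map Y euclidean F)"
proof
  let ?G = "{U. \<exists>X. locally_convex_topology_on V X \<and> (\<forall>Y\<in>S. continuous_map Y X (\<lambda>f. f)) \<and> openin X U}"
  let ?P = "pullback_topology V F euclidean"
  {
    assume cont: "continuous_map (lc_inductive_limit V S) euclidean F"
    show "\<forall>Y\<in>S. continuous_map Y euclidean F"
    proof
      fix Y assume Y: "Y \<in> S"
      \<comment> \<open>The indiscrete topology, obtained from the zero functional, is always a
        competitor. It ensures that the generating sets cover \<open>V\<close>, which continuity
        into a generated topology requires.\<close>
      have triv: "V \<in> ?G"
      proof -
        have "fun_linear_on V (\<lambda>f. 0)" by (simp add: fun_linear_on_def)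
        then have "locally_convex_topology_on V (pullback_topology V (\<lambda>f. 0::complex) euclidean)"
          by (rule locally_convex_pullback[OF V])
        moreover have "continuous_map Z (pullback_topology V (\<lambda>f. 0::complex) euclidean) (\<lambda>f. f)" if "Z \<in> S" for Z
          using S[OF that] by (intro continuous_map_pullback') (auto simp: o_def)
        moreover have "openin (pullback_topology V (\<lambda>f. 0::complex) euclidean) V"
          by (auto simp: openin_pullback_topology intro: exI[of _ UNIV])
        ultimately show ?thesis by blast
      qed
      have "continuous_map Y (lc_inductive_limit V S) (\<lambda>f. f)"
        unfolding lc_inductive_limit_def
      proof (rule continuous_on_generated_topo)
        show "(\<lambda>f. f) ` topspace Y \<subseteq> \<Union>?G" using triv S[OF Y] by blast
        fix U assume "U \<in> ?G"
        then obtain X where "continuous_map Y X (\<lambda>f. f)" "openin X U" using Y by blast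
        then show "openin Y ((\<lambda>f. f) -` U \<inter> topspace Y)"
          by (simp add: continuous_map_alt)
      qed
      from continuous_map_compose[OF this cont] show "continuous_map Y euclidean F" by (simp add: o_def)
    qed
  }
  assume cont: "\<forall>Y\<in>S. continuous_map Y euclidean F"
  have P: "locally_convex_topology_on V ?P" using locally_convex_pullback[OF V F] .
  have "\<forall>Y\<in>S. continuous_map Y ?P (\<lambda>f. f)"
    using cont S by (intro ballI continuous_map_pullback') (auto simp: o_def)
  then have PG: "U \<in> ?G" if "openin ?P U" for U using P that by blast
  have "topspace (lc_inductive_limit V S) = V"
  proof
    show "topspace (lc_inductive_limit V S) \<subseteq> V"
      unfolding lc_inductive_limit_def topology_generated_by_topspace locally_convex_topology_on_def
      using openin_subset by blast
    have "openin ?P V" using P openin_topspace[of ?P] by (simp add: locally_convex_topology_on_def)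
    then show "V \<subseteq> topspace (lc_inductive_limit V S)"
      unfolding lc_inductive_limit_def topology_generated_by_topspace using PG by blast
  qed
  moreover have "openin (lc_inductive_limit V S) (F -` U \<inter> V)" if "open U" for U
    unfolding lc_inductive_limit_def using that
    by (intro topology_generated_by_Basis PG) (auto simp: openin_pullback_topology)
  ultimately show "continuous_map (lc_inductive_limit V S) euclidean F"
    by (simp add: continuous_map_alt)
qed


section \<open>Smooth functions and cutoffs\<close>

definition smooth :: "(real \<Rightarrow> complex) \<Rightarrow> bool" where
  "smooth f \<longleftrightarrow> (\<forall>k x. nth_deriv k f differentiable (at x))"

lemma nth_deriv_0 [simp]: "nth_deriv 0 f = f"
  and nth_deriv_Suc: "nth_deriv (Suc k) f = (\<lambda>x. vector_derivative (nth_deriv k f) (at x))"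
  by (simp_all add: nth_deriv_def)

lemma smooth_has_vector_derivative:
  "smooth f \<Longrightarrow> (nth_deriv k f has_vector_derivative nth_deriv (Suc k) f x) (at x)"
  by (simp add: smooth_def nth_deriv_Suc vector_derivative_works[symmetric])

lemma smooth_continuous: "smooth f \<Longrightarrow> isCont (nth_deriv k f) x"
  using smooth_has_vector_derivative has_vector_derivative_continuous by blast

text \<open>All iterated derivatives are found at once by guessing the whole sequence
  \<open>H\<close>; smoothness comes with it.\<close>

lemma nth_deriv_eqI:
  assumes "H 0 = f" "\<And>k x. (H k has_vector_derivative H (Suc k) x) (at x)"
  shows "nth_deriv k f = H k" and "smooth f"
proof -
  show *: "nth_deriv k f = H k" for k
    using assms by (induction k) (auto simp: nth_deriv_Suc vector_derivative_at)
  show "smooth f" unfolding smooth_def *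
    using assms(2) by (meson differentiableI_vector)
qed

lemma nth_deriv_const_zero [simp]: "nth_deriv k (\<lambda>x. 0) = (\<lambda>x. 0)"
  and smooth_zero: "smooth (\<lambda>x. 0)"
  by (rule nth_deriv_eqI[where H = "\<lambda>_ _. 0"]; auto intro!: derivative_eq_intros)+

lemma
  assumes "smooth f" "smooth g"
  shows nth_deriv_add: "nth_deriv k (\<lambda>x. f x + g x) = (\<lambda>x. nth_deriv k f x + nth_deriv k g x)"
    and smooth_add: "smooth (\<lambda>x. f x + g x)"
  using assms
  by (auto intro!: nth_deriv_eqI[where H = "\<lambda>k x. nth_deriv k f x + nth_deriv k g x"]
      has_vector_derivative_add smooth_has_vector_derivative)

lemma
  assumes "smooth f"
  shows nth_deriv_cmult: "nth_deriv k (\<lambda>x. c * f x) = (\<lambda>x. c * nth_deriv k f x)"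
    and smooth_cmult: "smooth (\<lambda>x. c * f x)"
  using assms
  by (auto intro!: nth_deriv_eqI[where H = "\<lambda>k x. c * nth_deriv k f x"]
      has_vector_derivative_mult_right smooth_has_vector_derivative)

lemma smooth_diff: "smooth f \<Longrightarrow> smooth g \<Longrightarrow> smooth (\<lambda>x. f x - g x)"
  using smooth_add[OF _ smooth_cmult[of g "-1"], of f] by simp

lemma smooth_affine:
  assumes "smooth f"
  shows "smooth (\<lambda>x. f (c * x + d))"
proof (rule nth_deriv_eqI[where H = "\<lambda>k x. of_real (c ^ k) * nth_deriv k f (c * x + d)"])
  fix k x
  have "((\<lambda>x. c * x + d) has_real_derivative c) (at x)"
    by (auto intro!: derivative_eq_intros)
  then have "((nth_deriv k f \<circ> (\<lambda>x. c * x + d)) has_vector_derivative (c *\<^sub>R nth_deriv (Suc k) f (c * x + d))) (at x)"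
    by (intro vector_diff_chain_at smooth_has_vector_derivative assms)
      (simp add: has_real_derivative_iff_has_vector_derivative)
  from has_vector_derivative_mult_right[OF this, of "of_real (c ^ k)"]
  show "((\<lambda>x. of_real (c ^ k) * nth_deriv k f (c * x + d)) has_vector_derivative
      of_real (c ^ Suc k) * nth_deriv (Suc k) f (c * x + d)) (at x)"
    by (simp add: o_def scaleR_conv_of_real mult_ac)
qed simp

text \<open>Pascal's rule, separated from the calculus: it is the inductive step of the Leibniz
  formula with \<open>a\<close> and \<open>b\<close> standing for the sequences of derivatives at
  one point.\<close>

lemma Leibniz_step:
  fixes a b :: "nat \<Rightarrow> 'a::comm_semiring_1"
  shows "(\<Sum>i\<le>k. of_nat (k choose i) * (a (Suc i) * b (k - i) + a i * b (Suc k - i))) =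
    (\<Sum>i\<le>Suc k. of_nat (Suc k choose i) * (a i * b (Suc k - i)))"
proof -
  have "(\<Sum>i\<le>Suc k. of_nat (Suc k choose i) * (a i * b (Suc k - i))) =
      a 0 * b (Suc k) + (\<Sum>i\<le>k. of_nat (k choose Suc i) * (a (Suc i) * b (k - i)))
        + (\<Sum>i\<le>k. of_nat (k choose i) * (a (Suc i) * b (k - i)))"
    by (subst sum.atMost_Suc_shift) (simp add: sum.distrib algebra_simps)
  also have "a 0 * b (Suc k) + (\<Sum>i\<le>k. of_nat (k choose Suc i) * (a (Suc i) * b (k - i))) =
      (\<Sum>i\<le>Suc k. of_nat (k choose i) * (a i * b (Suc k - i)))"
    by (subst sum.atMost_Suc_shift) simp
  also have "\<dots> = (\<Sum>i\<le>k. of_nat (k choose i) * (a i * b (Suc k - i)))"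
    by (simp add: binomial_eq_0)
  finally show ?thesis by (simp only: sum.distrib distrib_left add.commute)
qed

lemma
  assumes f: "smooth f" and g: "smooth g"
  shows nth_deriv_mult: "nth_deriv k (\<lambda>x. f x * g x) =
      (\<lambda>x. \<Sum>i\<le>k. of_nat (k choose i) * (nth_deriv i f x * nth_deriv (k - i) g x))"
    and smooth_mult: "smooth (\<lambda>x. f x * g x)"
proof -
  define H where "H k x = (\<Sum>i\<le>k. of_nat (k choose i) * (nth_deriv i f x * nth_deriv (k - i) g x))" for k x
  have "(H k has_vector_derivative H (Suc k) x) (at x)" for k x
  proof -
    have "(H k has_vector_derivative (\<Sum>i\<le>k. of_nat (k choose i) *
        (nth_deriv i f x * nth_deriv (Suc (k - i)) g x + nth_deriv (Suc i) f x * nth_deriv (k - i) g x))) (at x)"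
      unfolding H_def
      by (intro has_vector_derivative_sum has_vector_derivative_mult_right has_vector_derivative_mult
          smooth_has_vector_derivative f g)
    also have "(\<Sum>i\<le>k. of_nat (k choose i) *
        (nth_deriv i f x * nth_deriv (Suc (k - i)) g x + nth_deriv (Suc i) f x * nth_deriv (k - i) g x)) =
        H (Suc k) x"
      unfolding H_def Leibniz_step[symmetric, of k "\<lambda>i. nth_deriv i f x" "\<lambda>i. nth_deriv i g x"]
      by (intro sum.cong) (auto simp: Suc_diff_le add.commute)
    finally show ?thesis .
  qed
  note deriv = this
  have H0: "H 0 = (\<lambda>x. f x * g x)" by (simp add: H_def fun_eq_iff)
  show "smooth (\<lambda>x. f x * g x)" using nth_deriv_eqI(2)[of H, OF H0 deriv] .
  show "nth_deriv k (\<lambda>x. f x * g x) =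
      (\<lambda>x. \<Sum>i\<le>k. of_nat (k choose i) * (nth_deriv i f x * nth_deriv (k - i) g x))"
    using nth_deriv_eqI(1)[of H, OF H0 deriv] by (simp only: H_def[abs_def])
qed

lemma smooth_antiderivative:
  assumes "smooth f"
  obtains F where "smooth F" "\<And>x. (F has_vector_derivative f x) (at x)"
proof -
  have "\<exists>F. \<forall>x :: real. -\<infinity> < ereal x \<longrightarrow> ereal x < \<infinity> \<longrightarrow> (F has_vector_derivative f x) (at x)"
    using smooth_continuous[OF assms, where k = 0] by (intro einterval_antiderivative) auto
  then obtain F where F: "\<And>x. (F has_vector_derivative f x) (at x)" by auto
  moreover have "smooth F"
  proof (rule nth_deriv_eqI)
    show "((case k of 0 \<Rightarrow> F | Suc j \<Rightarrow> nth_deriv j f) has_vector_derivative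
        (case Suc k of 0 \<Rightarrow> F | Suc j \<Rightarrow> nth_deriv j f) x) (at x)" for k x
      using F smooth_has_vector_derivative[OF assms] by (cases k) auto
  qed simp
  ultimately show thesis using that by blast
qed

lemma nth_deriv_zero_on_open:
  assumes "open U" "\<And>x. x \<in> U \<Longrightarrow> f x = 0" "x \<in> U"
  shows "nth_deriv k f x = 0"
  using assms(3)
proof (induction k arbitrary: x)
  case (Suc k)
  have "(nth_deriv k f has_vector_derivative 0) (at x)"
    using Suc.IH Suc.prems
    by (intro has_vector_derivative_transform_within_open[OF has_vector_derivative_const assms(1)]) auto
  then show ?case by (simp add: nth_deriv_Suc vector_derivative_at)
qed (use assms in auto)

section \<open>A smooth step function and cutoffs\<close>

lemma poly_mult_exp_neg_tendsto_0:
  fixes p :: "real poly"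
  shows "((\<lambda>x. poly p x * exp (- x)) \<longlongrightarrow> 0) at_top"
proof -
  have "((\<lambda>x. \<Sum>i\<le>degree p. coeff p i * (x ^ i / exp x)) \<longlongrightarrow> (\<Sum>i\<le>degree p. coeff p i * 0)) at_top"
    by (intro tendsto_intros tendsto_power_div_exp_0)
  then show ?thesis
    by (simp add: poly_altdef sum_distrib_right exp_minus divide_inverse mult.assoc)
qed

text \<open>The family of functions equal to a polynomial in \<open>1 / x\<close> times
  \<open>exp (- (1 / x))\<close> for positive \<open>x\<close> and 0 elsewhere is closed under
  differentiation: the chain and product rules turn \<open>p\<close> into
  \<open>X^2 * (p - p')\<close>. Only the origin needs a limit.\<close>

lemma flat_exp_has_derivative:
  fixes p :: "real poly"
  defines "g \<equiv> \<lambda>p x. if x > 0 then poly p (1 / x) * exp (- (1 / x)) else 0"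
  shows "(g p has_real_derivative g (monom 1 2 * (p - pderiv p)) x) (at x)"
proof -
  consider "x > 0" | "x < 0" | "x = 0" by linarith
  then show ?thesis
  proof cases
    case 1
    have "((\<lambda>x. poly p (1 / x) * exp (- (1 / x))) has_real_derivative g (monom 1 2 * (p - pderiv p)) x) (at x)"
      using 1 by (auto intro!: derivative_eq_intros simp: g_def poly_monom field_simps power2_eq_square)
    then show ?thesis
      by (rule has_field_derivative_transform_within_open[where S = "{0<..}"]) (use 1 in \<open>auto simp: g_def\<close>)
  next
    case 2
    then have "((\<lambda>x. 0) has_real_derivative g (monom 1 2 * (p - pderiv p)) x) (at x)"
      by (simp add: g_def)
    then show ?thesis
      by (rule has_field_derivative_transform_within_open[where S = "{..<0}"]) (use 2 in \<open>auto simp: g_def\<close>)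
  next
    case 3
    have "((\<lambda>h. g p h / h) \<longlongrightarrow> 0) (at_left 0)"
      by (rule Lim_transform_eventually[OF tendsto_const]) (auto simp: g_def eventually_at_filter)
    moreover have "((\<lambda>h. g p h / h) \<longlongrightarrow> 0) (at_right 0)"
    proof (rule Lim_transform_eventually)
      \<comment> \<open>\<open>pCons 0 p\<close> is \<open>X * p\<close>: in the variable
        \<open>1 / h\<close> it absorbs the division by \<open>h\<close> in the difference
        quotient.\<close>
      show "((\<lambda>h. poly (pCons 0 p) (inverse h) * exp (- inverse h)) \<longlongrightarrow> 0) (at_right 0)"
        by (rule filterlim_compose[OF poly_mult_exp_neg_tendsto_0 filterlim_inverse_at_top_right])
      show "\<forall>\<^sub>F h in at_right 0. poly (pCons 0 p) (inverse h) * exp (- inverse h) = g p h / h"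
        by (auto simp: g_def eventually_at_filter divide_inverse)
    qed
    ultimately show ?thesis
      using 3 by (simp add: has_field_derivative_iff filterlim_split_at g_def)
  qed
qed

lemma smooth_flat_exp: "smooth (\<lambda>x. of_real (if x > 0 then exp (- (1 / x)) else 0))"
proof (rule nth_deriv_eqI)
  define P :: "nat \<Rightarrow> real poly" where "P = rec_nat 1 (\<lambda>_ p. monom 1 2 * (p - pderiv p))"
  let ?H = "\<lambda>k x. complex_of_real (if x > 0 then poly (P k) (1 / x) * exp (- (1 / x)) else 0)"
  show "?H 0 = (\<lambda>x. of_real (if x > 0 then exp (- (1 / x)) else 0))" by (auto simp: P_def)
  show "(?H k has_vector_derivative ?H (Suc k) x) (at x)" for k x
  proof -
    have "P (Suc k) = monom 1 2 * (P k - pderiv (P k))" by (simp add: P_def)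
    then show ?thesis using flat_exp_has_derivative[of "P k" x]
      by (intro has_vector_derivative_of_real) (simp only: has_real_derivative_iff_has_vector_derivative)
  qed
qed

text \<open>The normalised antiderivative of a bump that is positive exactly on the open unit
  interval.\<close>

lemma smooth_step:
  obtains \<theta> where "smooth \<theta>" "\<And>x. x \<le> 0 \<Longrightarrow> \<theta> x = 0" "\<And>x. x \<ge> 1 \<Longrightarrow> \<theta> x = 1"
proof -
  define e where "e x = (if x > 0 then exp (- (1 / x)) else 0)" for x :: real
  define b where "b x = of_real (e x) * complex_of_real (e (1 - x))" for x
  have "smooth (\<lambda>x. of_real (e x))" unfolding e_def by (rule smooth_flat_exp)
  from smooth_mult[OF this smooth_affine[OF this, of "-1" 1]] have "smooth b"
    by (simp add: b_def[abs_def])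
  then obtain B where B: "smooth B" "\<And>x. (B has_vector_derivative b x) (at x)"
    using smooth_antiderivative by blast
  have const: "B x = B y" if "x < y" "y \<le> 0 \<or> 1 \<le> x" for x y
  proof (rule has_vector_derivative_zero_constant[of "{x..y}" B])
    show "(B has_vector_derivative 0) (at z within {x..y})" if "z \<in> {x..y}" for z
    proof -
      have "b z = 0" using \<open>z \<in> {x..y}\<close> \<open>y \<le> 0 \<or> 1 \<le> x\<close> by (auto simp: b_def e_def)
      then show ?thesis using B(2)[of z] has_vector_derivative_at_within by force
    qed
  qed (use \<open>x < y\<close> in auto)
  \<comment> \<open>The total mass of the bump is nonzero, so dividing by \<open>B 1 - B 0\<close>
    is legitimate.\<close>
  have "Re (B 0) < Re (B 1)"
  proof (rule DERIV_pos_imp_increasing_open[of 0 1 "\<lambda>x. Re (B x)"])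
    have d: "((\<lambda>x. Re (B x)) has_real_derivative Re (b x)) (at x)" for x
      using B(2)[of x] by (simp add: has_vector_derivative_complex_iff)
    show "\<exists>y. ((\<lambda>x. Re (B x)) has_real_derivative y) (at x) \<and> 0 < y" if "0 < x" "x < 1" for x
      using d[of x] that by (intro exI[of _ "Re (b x)"]) (auto simp: b_def e_def)
    show "continuous_on {0..1} (\<lambda>x. Re (B x))"
      by (rule DERIV_continuous_on[OF has_field_derivative_at_within[OF d]])
  qed simp
  then have ne: "B 1 - B 0 \<noteq> 0" by auto
  show thesis
  proof
    let ?\<theta> = "\<lambda>x. inverse (B 1 - B 0) * (B x + (- B 0))"
    have "smooth (\<lambda>x. - B 0)"
      by (rule nth_deriv_eqI[where H = "\<lambda>k x. if k = 0 then - B 0 else 0"]) auto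
    then show "smooth ?\<theta>" by (intro smooth_cmult smooth_add B)
    show "?\<theta> x = 0" if "x \<le> 0" for x using const[of x 0] that by (cases "x = 0") auto
    show "?\<theta> x = 1" if "x \<ge> 1" for x using const[of 1 x] that ne by (cases "x = 1") auto
  qed
qed

text \<open>A compact convex set of reals is a closed interval, so two rescaled steps suffice.
  Having the value 1 on a neighbourhood of \<open>K\<close>, and not just on \<open>K\<close>, makes
  differences of cutoffs vanish there with all derivatives.\<close>

lemma smooth_cutoff:
  fixes I K :: "real set"
  assumes I: "open I" and K: "compact K" "convex K" "K \<subseteq> I"
  obtains \<psi> U L where "smooth \<psi>" "open U" "K \<subseteq> U" "\<And>x. x \<in> U \<Longrightarrow> \<psi> x = 1"
    "compact L" "L \<subseteq> I" "\<And>x. x \<notin> L \<Longrightarrow> \<psi> x = 0"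
proof (cases "K = {}")
  case True
  then show thesis using that[of "\<lambda>x. 0" "{}" "{}"] smooth_zero by auto
next
  case False
  obtain l u where lu: "K = {l..u}"
    using K convex_connected connected_compact_interval_1 by metis
  have "l \<le> u" using False lu by auto
  then have "l \<in> I" "u \<in> I" using K(3) lu by auto
  obtain d where d: "d > 0" "cball l d \<subseteq> I" using I \<open>l \<in> I\<close> unfolding open_contains_cball by blast
  obtain d' where d': "d' > 0" "cball u d' \<subseteq> I" using I \<open>u \<in> I\<close> unfolding open_contains_cball by blast
  \<comment> \<open>Halved because each end needs two margins of width \<open>e\<close>: one where
    the cutoff is still 1 and one for the ramp.\<close>
  define e where "e = min d d' / 2"
  have e: "e > 0" using d d' by (simp add: e_def)
  have sub: "{l - 2 * e..u + 2 * e} \<subseteq> I"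
  proof
    fix x assume x: "x \<in> {l - 2 * e..u + 2 * e}"
    have "2 * e \<le> d" "2 * e \<le> d'" by (auto simp: e_def)
    then have "x \<in> cball l d \<or> x \<in> {l..u} \<or> x \<in> cball u d'"
      using x unfolding mem_cball dist_real_def atLeastAtMost_iff by linarith
    then show "x \<in> I" using d d' K lu by blast
  qed
  obtain \<theta> where \<theta>: "smooth \<theta>" "\<And>x. x \<le> 0 \<Longrightarrow> \<theta> x = 0" "\<And>x. x \<ge> 1 \<Longrightarrow> \<theta> x = 1"
    using smooth_step by blast
  \<comment> \<open>The first step rises from \<open>l - 2 * e\<close> to \<open>l - e\<close>; the
    second, subtracted, rises from \<open>u + e\<close> to \<open>u + 2 * e\<close>.\<close>
  define \<psi> where "\<psi> x = \<theta> (1 / e * x + (2 - l / e)) + (-1) * \<theta> (1 / e * x + (- 1 - u / e))" for x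
  show thesis
  proof (rule that)
    show "smooth \<psi>" unfolding \<psi>_def by (intro smooth_add smooth_cmult smooth_affine \<theta>(1))
    show "open {l - e<..<u + e}" "compact {l - 2 * e..u + 2 * e}" by auto
    show "K \<subseteq> {l - e<..<u + e}" using e lu by auto
    show "{l - 2 * e..u + 2 * e} \<subseteq> I" by fact
    show "\<psi> x = 1" if "x \<in> {l - e<..<u + e}" for x
    proof -
      have "1 / e * x + (2 - l / e) \<ge> 1" "1 / e * x + (- 1 - u / e) \<le> 0"
        using that e by (auto simp: field_simps)
      then show ?thesis by (simp add: \<psi>_def \<theta>)
    qed
    show "\<psi> x = 0" if "x \<notin> {l - 2 * e..u + 2 * e}" for x
    proof (cases "x < l - 2 * e")
      case True
      then have "1 / e * x + (2 - l / e) \<le> 0" "1 / e * x + (- 1 - u / e) \<le> 0"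
        using e \<open>l \<le> u\<close> by (auto simp: field_simps)
      then show ?thesis by (simp add: \<psi>_def \<theta>)
    next
      case False
      then have "1 / e * x + (2 - l / e) \<ge> 1" "1 / e * x + (- 1 - u / e) \<ge> 1"
        using that e \<open>l \<le> u\<close> by (auto simp: field_simps)
      then show ?thesis by (simp add: \<psi>_def \<theta>)
    qed
  qed
qed

section \<open>Classical test functions and their norms\<close>

lemma space_D_step_iff: "f \<in> space_D_step K \<longleftrightarrow> smooth f \<and> (\<forall>x. x \<notin> K \<longrightarrow> f x = 0)"
  by (simp add: space_D_step_def smooth_def)

lemma fun_subspace_D_step: "fun_subspace (space_D_step K)"
  unfolding fun_subspace_def by (auto simp: space_D_step_iff intro: smooth_zero smooth_add smooth_cmult)

lemma space_D_step_mono: "K \<subseteq> L \<Longrightarrow> space_D_step K \<subseteq> space_D_step L"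
  by (auto simp: space_D_step_def)

lemma nth_deriv_support:
  assumes "closed K" "f \<in> space_D_step K" "x \<notin> K"
  shows "nth_deriv k f x = 0"
  using nth_deriv_zero_on_open[of "- K" f x k] assms by (auto simp: space_D_step_iff)

lemma nth_deriv_bounded:
  assumes "compact K" "f \<in> space_D_step K"
  obtains B where "\<And>x. norm (nth_deriv k f x) \<le> B"
proof -
  have "continuous_on K (nth_deriv k f)"
    using smooth_continuous assms by (auto simp: space_D_step_iff intro: continuous_at_imp_continuous_on)
  then have "bounded (nth_deriv k f ` K)" using assms compact_continuous_image compact_imp_bounded by blast
  then obtain B where B: "B > 0" "\<forall>y\<in>nth_deriv k f ` K. norm y \<le> B" using bounded_pos by blast
  have "norm (nth_deriv k f x) \<le> B" for x
    using B nth_deriv_support[OF compact_imp_closed assms(2), OF assms(1), of x k] by (cases "x \<in> K") auto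
  then show thesis using that by blast
qed

text \<open>A real supremum is informative only for a bounded set. Compact support provides the
  bound, and these two facts then replace the definition of \<open>D_norm\<close>.\<close>

lemma
  assumes "compact K" "f \<in> space_D_step K"
  shows nth_deriv_le_D_norm: "i \<le> k \<Longrightarrow> norm (nth_deriv i f x) \<le> D_norm k f"
    and D_norm_leI: "(\<And>i x. i \<le> k \<Longrightarrow> norm (nth_deriv i f x) \<le> M) \<Longrightarrow> D_norm k f \<le> M"
proof -
  have bdd: "bdd_above (range (\<lambda>x. norm (nth_deriv i f x)))" for i
    using nth_deriv_bounded[OF assms, of i] by (metis bdd_aboveI2)
  show "norm (nth_deriv i f x) \<le> D_norm k f" if "i \<le> k"
  proof -
    have "norm (nth_deriv i f x) \<le> (SUP x. norm (nth_deriv i f x))" by (intro cSUP_upper bdd) simp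
    also have "\<dots> \<le> D_norm k f" unfolding D_norm_def using that by (intro Max_ge) auto
    finally show ?thesis .
  qed
  show "D_norm k f \<le> M" if "\<And>i x. i \<le> k \<Longrightarrow> norm (nth_deriv i f x) \<le> M"
    unfolding D_norm_def using that by (intro Max.boundedI) (auto intro!: cSUP_least)
qed

lemma D_norm_nonneg:
  assumes "compact K" "f \<in> space_D_step K"
  shows "0 \<le> D_norm k f"
  using order_trans[OF norm_ge_zero nth_deriv_le_D_norm[OF assms, of 0 k 0]] by simp

lemma D_norm_mono:
  assumes "compact K" "f \<in> space_D_step K" "j \<le> k"
  shows "D_norm j f \<le> D_norm k f"
  using assms by (intro D_norm_leI nth_deriv_le_D_norm) auto

lemma fun_seminorm_on_D_norm:
  assumes K: "compact K"
  shows "fun_seminorm_on (space_D_step K) (D_norm k)"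
proof -
  have le: "D_norm k (\<lambda>x. c * f x) \<le> cmod c * D_norm k f" if f: "f \<in> space_D_step K" for c f
    using nth_deriv_le_D_norm[OF K f] f
    by (intro D_norm_leI[OF K] fun_subspace_scale fun_subspace_D_step)
      (auto simp: nth_deriv_cmult space_D_step_iff norm_mult intro: mult_left_mono)
  have "D_norm k (\<lambda>x. c * f x) = cmod c * D_norm k f" if f: "f \<in> space_D_step K" for c f
  proof (cases "c = 0")
    case True
    then show ?thesis using le[OF f, of c] D_norm_nonneg[OF K fun_subspace_scale[OF fun_subspace_D_step f], of k c]
      by simp
  next
    case False
    \<comment> \<open>The reverse inequality is \<open>le\<close> for the factor
      \<open>1 / c\<close> applied to \<open>c * f\<close>.\<close>
    have "D_norm k f \<le> cmod (1 / c) * D_norm k (\<lambda>x. c * f x)"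
      using le[OF fun_subspace_scale[OF fun_subspace_D_step f], of "1 / c" c] False by simp
    then show ?thesis using le[OF f, of c] False by (simp add: norm_divide field_simps)
  qed
  moreover have "D_norm k (\<lambda>x. f x + g x) \<le> D_norm k f + D_norm k g"
    if f: "f \<in> space_D_step K" and g: "g \<in> space_D_step K" for f g
    using nth_deriv_le_D_norm[OF K f] nth_deriv_le_D_norm[OF K g] f g
    by (intro D_norm_leI[OF K] fun_subspace_add fun_subspace_D_step)
      (auto simp: nth_deriv_add space_D_step_iff intro: norm_triangle_mono)
  ultimately show ?thesis using D_norm_nonneg[OF K] by (simp add: fun_seminorm_on_def)
qed

lemma fun_subspace_D:
  "fun_subspace (space_D I)"
  unfolding fun_subspace_def
proof (intro conjI ballI allI)
  show "(\<lambda>x. 0) \<in> space_D I"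
    using fun_subspace_zero[OF fun_subspace_D_step, of "{}"] by (auto simp: space_D_def)
  show "(\<lambda>x. c * f x) \<in> space_D I" if "f \<in> space_D I" for c f
    using that fun_subspace_scale[OF fun_subspace_D_step] by (auto simp: space_D_def)
  fix f g assume "f \<in> space_D I" "g \<in> space_D I"
  then obtain K L where K: "compact K" "K \<subseteq> I" "f \<in> space_D_step K"
    and L: "compact L" "L \<subseteq> I" "g \<in> space_D_step L" by (auto simp: space_D_def)
  then have "f \<in> space_D_step (K \<union> L)" "g \<in> space_D_step (K \<union> L)"
    using space_D_step_mono[of K "K \<union> L"] space_D_step_mono[of L "K \<union> L"] by auto
  then have "(\<lambda>x. f x + g x) \<in> space_D_step (K \<union> L)" using fun_subspace_add fun_subspace_D_step by blast
  then show "(\<lambda>x. f x + g x) \<in> space_D I"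
    unfolding space_D_def using K L by (intro UN_I[of "K \<union> L"]) auto
qed

text \<open>By the Leibniz formula every term carries a derivative of \<eta>, so only the values of
  the derivatives of \<open>f\<close> on \<open>A\<close> matter. The constant \<open>B\<close> is
  chosen before \<open>f\<close>.\<close>

lemma nth_deriv_mult_bound:
  assumes \<eta>: "compact L" "\<eta> \<in> space_D_step L" and A: "\<And>i x. x \<notin> A \<Longrightarrow> nth_deriv i \<eta> x = 0"
  shows "\<exists>B\<ge>0. \<forall>f M. smooth f \<longrightarrow> 0 \<le> M \<longrightarrow> (\<forall>j\<le>k. \<forall>y\<in>A. norm (nth_deriv j f y) \<le> M) \<longrightarrow>
    (\<forall>i\<le>k. \<forall>x. norm (nth_deriv i (\<lambda>x. \<eta> x * f x) x) \<le> B * M)"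
proof -
  \<comment> \<open>The outer sum over \<open>i\<close> serves as an upper bound for the inner sums
    of all orders up to \<open>k\<close>.\<close>
  let ?B = "\<Sum>i\<le>k. \<Sum>j\<le>i. of_nat (i choose j) * D_norm k \<eta>"
  have D0: "0 \<le> D_norm k \<eta>" using D_norm_nonneg[OF \<eta>] .
  then have "?B \<ge> 0" by (intro sum_nonneg) auto
  moreover have "norm (nth_deriv i (\<lambda>x. \<eta> x * f x) x) \<le> ?B * M"
    if f: "smooth f" and M: "M \<ge> 0" and fM: "\<forall>j\<le>k. \<forall>y\<in>A. norm (nth_deriv j f y) \<le> M"
      and i: "i \<le> k" for f M i x
  proof -
    have "norm (nth_deriv j \<eta> x * nth_deriv (i - j) f x) \<le> D_norm k \<eta> * M" if "j \<le> i" for j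
    proof (cases "x \<in> A")
      case True
      then show ?thesis unfolding norm_mult
        using that i M D0 fM by (intro mult_mono nth_deriv_le_D_norm[OF \<eta>]) auto
    next
      case False
      then show ?thesis using A M D0 by simp
    qed
    then have "norm (nth_deriv i (\<lambda>x. \<eta> x * f x) x) \<le> (\<Sum>j\<le>i. of_nat (i choose j) * (D_norm k \<eta> * M))"
      using \<eta>(2) f by (auto simp: nth_deriv_mult space_D_step_iff norm_mult intro!: sum_norm_le mult_left_mono)
    also have "\<dots> = (\<Sum>j\<le>i. of_nat (i choose j) * D_norm k \<eta>) * M"
      by (simp add: sum_distrib_right mult.assoc)
    also have "\<dots> \<le> ?B * M"
      using i D0 M by (intro mult_right_mono member_le_sum) (auto intro!: sum_nonneg)
    finally show ?thesis .
  qed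
  ultimately show ?thesis by blast
qed


section \<open>Functions with one-sided essential limits\<close>

text \<open>Quantifying over this pair lets both sides be treated by a single argument.\<close>

definition ess_sides :: "real \<Rightarrow> real filter set" where
  "ess_sides t = {ess_at_right t, ess_at_left t}"

lemma eventually_ess_at_right:
  "eventually P (ess_at_right t) \<longleftrightarrow> (\<exists>b>t. AE x in lebesgue. t < x \<and> x < b \<longrightarrow> P x)"
proof
  assume "eventually P (ess_at_right t)"
  then obtain Q R where Q: "eventually Q (at_right t)" and R: "AE x in lebesgue. R x"
    and P: "\<And>x. Q x \<Longrightarrow> R x \<Longrightarrow> P x"
    unfolding ess_at_right_def eventually_inf by blast
  obtain b where "b > t" "\<forall>y>t. y < b \<longrightarrow> Q y" using Q unfolding eventually_at_right_field by blast
  then show "\<exists>b>t. AE x in lebesgue. t < x \<and> x < b \<longrightarrow> P x"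
    using R P by (intro exI[of _ b] conjI) (auto elim: eventually_mono)
next
  assume "\<exists>b>t. AE x in lebesgue. t < x \<and> x < b \<longrightarrow> P x"
  then obtain b where b: "b > t" "AE x in lebesgue. t < x \<and> x < b \<longrightarrow> P x" by blast
  then have "eventually (\<lambda>x. t < x \<and> x < b) (at_right t)"
    unfolding eventually_at_right_field by blast
  then show "eventually P (ess_at_right t)"
    unfolding ess_at_right_def eventually_inf using b(2) by blast
qed

lemma eventually_ess_at_left:
  "eventually P (ess_at_left t) \<longleftrightarrow> (\<exists>b<t. AE x in lebesgue. b < x \<and> x < t \<longrightarrow> P x)"
proof
  assume "eventually P (ess_at_left t)"
  then obtain Q R where Q: "eventually Q (at_left t)" and R: "AE x in lebesgue. R x"
    and P: "\<And>x. Q x \<Longrightarrow> R x \<Longrightarrow> P x"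
    unfolding ess_at_left_def eventually_inf by blast
  obtain b where "b < t" "\<forall>y>b. y < t \<longrightarrow> Q y" using Q unfolding eventually_at_left_field by blast
  then show "\<exists>b<t. AE x in lebesgue. b < x \<and> x < t \<longrightarrow> P x"
    using R P by (intro exI[of _ b] conjI) (auto elim: eventually_mono)
next
  assume "\<exists>b<t. AE x in lebesgue. b < x \<and> x < t \<longrightarrow> P x"
  then obtain b where b: "b < t" "AE x in lebesgue. b < x \<and> x < t \<longrightarrow> P x" by blast
  then have "eventually (\<lambda>x. b < x \<and> x < t) (at_left t)"
    unfolding eventually_at_left_field by blast
  then show "eventually P (ess_at_left t)"
    unfolding ess_at_left_def eventually_inf using b(2) by blast
qed

lemma not_AE_outside_interval:
  fixes a b :: real
  assumes "a < b"
  shows "\<not> (AE x in lebesgue. a < x \<and> x < b \<longrightarrow> False)"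
proof
  assume "AE x in lebesgue. a < x \<and> x < b \<longrightarrow> False"
  then have "AE x in lebesgue. x \<notin> {a<..<b}" by (auto elim: eventually_mono)
  then have "{a<..<b} \<in> null_sets lebesgue" by (subst AE_iff_null_sets) auto
  then show False using assms by (simp add: null_sets_def)
qed

text \<open>Nonempty open intervals are not null sets; hence one-sided essential limits are
  unique.\<close>

lemma ess_sides_nontrivial: "F \<in> ess_sides t \<Longrightarrow> F \<noteq> bot"
  using not_AE_outside_interval
  by (auto simp: ess_sides_def trivial_limit_def eventually_ess_at_right eventually_ess_at_left)

lemma ess_sides_le_at: "F \<in> ess_sides t \<Longrightarrow> F \<le> at t"
  by (auto simp: ess_sides_def ess_at_right_def ess_at_left_def at_le intro: le_infI1)

lemma ess_sides_le_ae: "F \<in> ess_sides t \<Longrightarrow> F \<le> ae_filter lebesgue"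
  by (auto simp: ess_sides_def ess_at_right_def ess_at_left_def)

lemma AE_lebesgue_on_open:
  "open I \<Longrightarrow> (AE x in lebesgue_on I. P x) \<longleftrightarrow> (AE x in lebesgue. x \<in> I \<longrightarrow> P x)" for I :: "real set"
  by (intro AE_restrict_space_iff) auto

lemma AE_imp_eventually_ess_sides:
  assumes "open U" "t \<in> U" "AE x in lebesgue. x \<in> U \<longrightarrow> P x" "F \<in> ess_sides t"
  shows "eventually P F"
proof -
  have "eventually (\<lambda>x. x \<in> U) F"
    using filter_leD[OF ess_sides_le_at[OF assms(4)] eventually_at_in_open'[OF assms(1,2)]] .
  moreover have "eventually (\<lambda>x. x \<in> U \<longrightarrow> P x) F"
    using filter_leD[OF ess_sides_le_ae[OF assms(4)] assms(3)] .
  ultimately show ?thesis by eventually_elim blast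
qed

text \<open>Each \<open>t\<close> has an open interval around it on which \<open>P\<close> holds
  almost everywhere, the point \<open>t\<close> itself being null. By Lindelof countably many of
  these intervals cover \<open>U\<close>.\<close>

lemma eventually_ess_sides_imp_AE:
  assumes U: "open U" and P: "\<And>t F. t \<in> U \<Longrightarrow> F \<in> ess_sides t \<Longrightarrow> eventually P F"
  shows "AE x in lebesgue. x \<in> U \<longrightarrow> P x"
proof -
  have "\<exists>V. open V \<and> t \<in> V \<and> (AE x in lebesgue. x \<in> V \<longrightarrow> P x)" if t: "t \<in> U" for t
  proof -
    obtain b where b: "b > t" "AE x in lebesgue. t < x \<and> x < b \<longrightarrow> P x"
      using P[OF t, of "ess_at_right t"] unfolding ess_sides_def eventually_ess_at_right by auto
    obtain a where a: "a < t" "AE x in lebesgue. a < x \<and> x < t \<longrightarrow> P x"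
      using P[OF t, of "ess_at_left t"] unfolding ess_sides_def eventually_ess_at_left by auto
    have "AE x in lebesgue. x \<noteq> t"
      using AE_lborel_singleton AE_completion by blast
    with a(2) b(2) have "AE x in lebesgue. x \<in> {a<..<b} \<longrightarrow> P x"
      by eventually_elim auto
    then show ?thesis using a b by (intro exI[of _ "{a<..<b}"]) auto
  qed
  then obtain V where V: "\<And>t. t \<in> U \<Longrightarrow> open (V t)" "\<And>t. t \<in> U \<Longrightarrow> t \<in> V t"
    "\<And>t. t \<in> U \<Longrightarrow> AE x in lebesgue. x \<in> V t \<longrightarrow> P x" by metis
  obtain \<F> where \<F>: "\<F> \<subseteq> V ` U" "countable \<F>" "\<Union>\<F> = \<Union>(V ` U)"
    using Lindelof[of "V ` U"] V(1) by blast
  have "AE x in lebesgue. \<forall>S\<in>\<F>. x \<in> S \<longrightarrow> P x"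
    using \<F> V(3) by (intro AE_ball_countable') auto
  then show ?thesis
  proof eventually_elim
    case (elim x)
    show ?case
    proof
      assume "x \<in> U"
      then have "x \<in> \<Union>\<F>" using V(2) \<F>(3) by blast
      then show "P x" using elim by blast
    qed
  qed
qed

section \<open>Essential suprema\<close>

definition ess_bounded :: "real set \<Rightarrow> (real \<Rightarrow> complex) set" where
  "ess_bounded I = {g \<in> borel_measurable (lebesgue_on I). \<exists>C. AE x in lebesgue_on I. norm (g x) \<le> C}"

lemma fun_subspace_ess_bounded: "fun_subspace (ess_bounded I)"
  unfolding fun_subspace_def
proof (intro conjI ballI allI)
  show "(\<lambda>x. 0) \<in> ess_bounded I" by (auto simp: ess_bounded_def intro!: exI[of _ 0])
  fix f assume "f \<in> ess_bounded I"
  then obtain C where f: "f \<in> borel_measurable (lebesgue_on I)" "AE x in lebesgue_on I. norm (f x) \<le> C"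
    by (auto simp: ess_bounded_def)
  have "AE x in lebesgue_on I. norm (c * f x) \<le> norm c * C" for c
    using f(2) by eventually_elim (auto simp: norm_mult intro: mult_left_mono)
  then show "(\<lambda>x. c * f x) \<in> ess_bounded I" for c
    using f(1) by (auto simp: ess_bounded_def)
  fix g assume "g \<in> ess_bounded I"
  then obtain D where g: "g \<in> borel_measurable (lebesgue_on I)" "AE x in lebesgue_on I. norm (g x) \<le> D"
    by (auto simp: ess_bounded_def)
  have "AE x in lebesgue_on I. norm (f x + g x) \<le> C + D"
    using f(2) g(2) by eventually_elim (rule norm_triangle_mono)
  then show "(\<lambda>x. f x + g x) \<in> ess_bounded I"
    using f(1) g(1) by (auto simp: ess_bounded_def)
qed

text \<open>True of every function: \<open>real_of_ereal\<close> sends infinite values to 0, and a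
  finite essential supremum of a norm cannot be negative.\<close>

lemma Linf_norm_nonneg: "0 \<le> Linf_norm I g"
proof (cases "esssup (lebesgue_on I) (\<lambda>x. ereal (norm (g x)))")
  case (real r)
  \<comment> \<open>\<open>esssup\<close> of a nonmeasurable function is the top element, so a
    finite value certifies measurability.\<close>
  have meas: "(\<lambda>x. ereal (norm (g x))) \<in> borel_measurable (lebesgue_on I)"
    using real esssup_non_measurable[of "\<lambda>x. ereal (norm (g x))" "lebesgue_on I"] by (auto simp: top_ereal_def)
  have "r \<ge> 0"
  proof (rule ccontr)
    assume "\<not> r \<ge> 0"
    have "AE x in lebesgue_on I. ereal (norm (g x)) \<le> ereal r"
      using esssup_AE[where M = "lebesgue_on I" and f = "\<lambda>x. ereal (norm (g x))"] real by simp
    \<comment> \<open>With a negative \<open>r\<close> the almost sure bound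
      \<open>norm (g x) \<le> r\<close> is contradictory, so every bound holds almost surely, even
      one below the essential supremum.\<close>
    then have "AE x in lebesgue_on I. ereal (norm (g x)) \<le> ereal (r - 1)"
    proof eventually_elim
      case (elim x)
      then have "norm (g x) \<le> r" by simp
      then show ?case using \<open>\<not> r \<ge> 0\<close> norm_ge_zero[of "g x"] by linarith
    qed
    from esssup_I[OF meas this] show False using real by simp
  qed
  then show ?thesis using real by (simp add: Linf_norm_def)
qed (auto simp: Linf_norm_def)

lemma Linf_norm_leI:
  assumes "g \<in> borel_measurable (lebesgue_on I)" "AE x in lebesgue_on I. norm (g x) \<le> M" "M \<ge> 0"
  shows "Linf_norm I g \<le> M"
proof -
  have "esssup (lebesgue_on I) (\<lambda>x. ereal (norm (g x))) \<le> ereal M"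
    using assms by (intro esssup_I) auto
  then show ?thesis unfolding Linf_norm_def using assms(3)
    by (cases "esssup (lebesgue_on I) (\<lambda>x. ereal (norm (g x)))") auto
qed

lemma AE_le_Linf_norm:
  assumes "g \<in> ess_bounded I"
  shows "AE x in lebesgue_on I. norm (g x) \<le> Linf_norm I g"
proof -
  obtain C where C: "AE x in lebesgue_on I. norm (g x) \<le> C" using assms by (auto simp: ess_bounded_def)
  have "esssup (lebesgue_on I) (\<lambda>x. ereal (norm (g x))) \<le> ereal C"
    using assms C by (intro esssup_I) (auto simp: ess_bounded_def)
  moreover have "AE x in lebesgue_on I. ereal (norm (g x)) \<le> esssup (lebesgue_on I) (\<lambda>x. ereal (norm (g x)))"
    by (rule esssup_AE)
  ultimately show ?thesis unfolding Linf_norm_def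
    by (cases "esssup (lebesgue_on I) (\<lambda>x. ereal (norm (g x)))") auto
qed

section \<open>The algebra of functions with one-sided limits and its derivatives\<close>

lemma alg_G_iff:
  "g \<in> alg_G I \<longleftrightarrow> g \<in> ess_bounded I \<and> (\<forall>t\<in>I. \<forall>F\<in>ess_sides t. (g \<longlongrightarrow> Lim F g) F)"
proof -
  have "(\<exists>l. (g \<longlongrightarrow> l) F) \<longleftrightarrow> (g \<longlongrightarrow> Lim F g) F" if "F \<in> ess_sides t" for F t
    using tendsto_Lim[of F g] ess_sides_nontrivial[OF that] by (auto simp: trivial_limit_def)
  then have "((\<exists>l. (g \<longlongrightarrow> l) (ess_at_right t)) \<and> (\<exists>l. (g \<longlongrightarrow> l) (ess_at_left t))) \<longleftrightarrow>
      (\<forall>F\<in>ess_sides t. (g \<longlongrightarrow> Lim F g) F)" for t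
    by (auto simp: ess_sides_def)
  then show ?thesis by (simp add: alg_G_def ess_bounded_def conj_assoc)
qed

lemma alg_G_tendsto: "g \<in> alg_G I \<Longrightarrow> t \<in> I \<Longrightarrow> F \<in> ess_sides t \<Longrightarrow> (g \<longlongrightarrow> Lim F g) F"
  by (simp add: alg_G_iff)

lemma is_G_deriv_iff:
  "is_G_deriv I g h \<longleftrightarrow> h \<in> alg_G I \<and>
     (\<forall>t\<in>I. \<forall>F\<in>ess_sides t. ((\<lambda>s. (g s - Lim F g) / of_real (s - t)) \<longlongrightarrow> Lim F h) F)"
  by (auto simp: is_G_deriv_def ess_sides_def)

lemma ess_Lim_eqI: "F \<in> ess_sides t \<Longrightarrow> (g \<longlongrightarrow> l) F \<Longrightarrow> Lim F g = l"
  using tendsto_Lim ess_sides_nontrivial by blast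

lemma ess_Lim_add:
  "f \<in> alg_G I \<Longrightarrow> g \<in> alg_G I \<Longrightarrow> t \<in> I \<Longrightarrow> F \<in> ess_sides t \<Longrightarrow>
    Lim F (\<lambda>x. f x + g x) = Lim F f + Lim F g"
  by (intro ess_Lim_eqI tendsto_add alg_G_tendsto)

lemma ess_Lim_cmult:
  "f \<in> alg_G I \<Longrightarrow> t \<in> I \<Longrightarrow> F \<in> ess_sides t \<Longrightarrow> Lim F (\<lambda>x. c * f x) = c * Lim F f"
  by (intro ess_Lim_eqI tendsto_mult_left alg_G_tendsto)

lemma ess_Lim_cong:
  assumes "open U" "t \<in> U" "AE x in lebesgue. x \<in> U \<longrightarrow> f x = g x" "F \<in> ess_sides t"
  shows "Lim F f = Lim F g"
  using AE_imp_eventually_ess_sides[OF assms] by (rule Lim_cong) simp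

lemma fun_subspace_alg_G: "fun_subspace (alg_G I)"
  unfolding fun_subspace_def
proof (intro conjI ballI allI)
  show "(\<lambda>x. 0) \<in> alg_G I"
    using fun_subspace_zero[OF fun_subspace_ess_bounded]
    by (auto simp: alg_G_iff ess_Lim_eqI[where l = 0])
  show "(\<lambda>x. f x + g x) \<in> alg_G I" if "f \<in> alg_G I" "g \<in> alg_G I" for f g
    using that fun_subspace_add[OF fun_subspace_ess_bounded, of f I g]
    by (subst alg_G_iff) (auto simp: ess_Lim_add alg_G_iff[of f] alg_G_iff[of g] intro!: tendsto_add)
  show "(\<lambda>x. c * f x) \<in> alg_G I" if "f \<in> alg_G I" for f c
    using that fun_subspace_scale[OF fun_subspace_ess_bounded, of f I c]
    by (subst alg_G_iff) (auto simp: ess_Lim_cmult alg_G_iff[of f] intro!: tendsto_mult_left)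
qed

lemma is_G_deriv_add:
  assumes "f \<in> alg_G I" "g \<in> alg_G I" "is_G_deriv I f f'" "is_G_deriv I g g'"
  shows "is_G_deriv I (\<lambda>x. f x + g x) (\<lambda>x. f' x + g' x)"
  unfolding is_G_deriv_iff
proof (intro conjI ballI)
  have f': "f' \<in> alg_G I" and g': "g' \<in> alg_G I" using assms by (auto simp: is_G_deriv_iff)
  then show "(\<lambda>x. f' x + g' x) \<in> alg_G I" by (intro fun_subspace_add fun_subspace_alg_G)
  fix t F assume t: "t \<in> I" and F: "F \<in> ess_sides t"
  have "((\<lambda>s. (f s - Lim F f) / of_real (s - t) + (g s - Lim F g) / of_real (s - t)) \<longlongrightarrow> Lim F f' + Lim F g') F"
    using assms t F by (intro tendsto_add) (auto simp: is_G_deriv_iff)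
  then show "((\<lambda>s. (f s + g s - Lim F (\<lambda>x. f x + g x)) / of_real (s - t)) \<longlongrightarrow> Lim F (\<lambda>x. f' x + g' x)) F"
    unfolding ess_Lim_add[OF assms(1,2) t F] ess_Lim_add[OF f' g' t F]
    by (simp add: add_divide_distrib diff_divide_distrib algebra_simps)
qed

lemma is_G_deriv_cmult:
  assumes "f \<in> alg_G I" "is_G_deriv I f f'"
  shows "is_G_deriv I (\<lambda>x. c * f x) (\<lambda>x. c * f' x)"
  unfolding is_G_deriv_iff
proof (intro conjI ballI)
  have f': "f' \<in> alg_G I" using assms by (auto simp: is_G_deriv_iff)
  then show "(\<lambda>x. c * f' x) \<in> alg_G I" by (intro fun_subspace_scale fun_subspace_alg_G)
  fix t F assume t: "t \<in> I" and F: "F \<in> ess_sides t"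
  have "((\<lambda>s. c * ((f s - Lim F f) / of_real (s - t))) \<longlongrightarrow> c * Lim F f') F"
    using assms t F by (intro tendsto_mult_left) (auto simp: is_G_deriv_iff)
  then show "((\<lambda>s. (c * f s - Lim F (\<lambda>x. c * f x)) / of_real (s - t)) \<longlongrightarrow> Lim F (\<lambda>x. c * f' x)) F"
    unfolding ess_Lim_cmult[OF assms(1) t F] ess_Lim_cmult[OF f' t F]
    by (simp add: right_diff_distrib)
qed

text \<open>Near each point, on either side, \<open>h\<close> is almost everywhere smaller than any
  given bound; this becomes an almost everywhere statement on \<open>U\<close> for each
  \<open>1 / (n + 1)\<close>, and countably many such statements combine.\<close>

lemma alg_G_zero_on:
  assumes U: "open U" "U \<subseteq> I" and h: "h \<in> alg_G I"
    and lim: "\<And>t F. t \<in> U \<Longrightarrow> F \<in> ess_sides t \<Longrightarrow> Lim F h = 0"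
  shows "AE x in lebesgue. x \<in> U \<longrightarrow> h x = 0"
proof -
  have "AE x in lebesgue. x \<in> U \<longrightarrow> norm (h x) < inverse (real (Suc n))" for n
  proof (rule eventually_ess_sides_imp_AE[OF U(1)])
    fix t F assume "t \<in> U" and F: "F \<in> ess_sides t"
    then have "(h \<longlongrightarrow> 0) F" using alg_G_tendsto[OF h, of t F] lim[of t F] U(2) by auto
    from order_tendstoD(2)[OF tendsto_norm_zero[OF this], of "inverse (real (Suc n))"]
    show "\<forall>\<^sub>F x in F. norm (h x) < inverse (real (Suc n))" by simp
  qed
  then have "AE x in lebesgue. \<forall>n. x \<in> U \<longrightarrow> norm (h x) < inverse (real (Suc n))"
    by (subst AE_all_countable) blast
  then show ?thesis
  proof eventually_elim
    case (elim x)
    show ?case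
    proof
      assume "x \<in> U"
      show "h x = 0"
      proof (rule ccontr)
        assume "h x \<noteq> 0"
        then obtain n where "inverse (real (Suc n)) < norm (h x)"
          using reals_Archimedean[of "norm (h x)"] by auto
        then show False using elim[rule_format, OF \<open>x \<in> U\<close>, of n] by linarith
      qed
    qed
  qed
qed

lemma is_G_deriv_cong:
  assumes U: "open U" "U \<subseteq> I" and fg: "AE x in lebesgue. x \<in> U \<longrightarrow> f x = g x"
    and f: "is_G_deriv I f f'" and t: "t \<in> U" "F \<in> ess_sides t"
  shows "((\<lambda>s. (g s - Lim F g) / of_real (s - t)) \<longlongrightarrow> Lim F f') F"
proof -
  have "((\<lambda>s. (f s - Lim F f) / of_real (s - t)) \<longlongrightarrow> Lim F f') F"
    using f t U by (auto simp: is_G_deriv_iff)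
  moreover have "eventually (\<lambda>s. (f s - Lim F f) / of_real (s - t) = (g s - Lim F g) / of_real (s - t)) F"
    using AE_imp_eventually_ess_sides[OF U(1) t(1) fg t(2)] ess_Lim_cong[OF U(1) t(1) fg t(2)]
    by (auto elim: eventually_mono)
  ultimately show ?thesis by (rule Lim_transform_eventually)
qed

text \<open>The one-sided limits of a derivative are limits of difference quotients, and these see
  only the almost everywhere class near the point. The case \<open>U = I\<close> tames the choice in
  \<open>G_deriv\<close>; smaller \<open>U\<close> make differentiation local.\<close>

lemma is_G_deriv_unique:
  assumes U: "open U" "U \<subseteq> I" and fg: "AE x in lebesgue. x \<in> U \<longrightarrow> f x = g x"
    and f: "is_G_deriv I f f'" and g: "is_G_deriv I g g'"
  shows "AE x in lebesgue. x \<in> U \<longrightarrow> f' x = g' x"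
proof -
  have f': "f' \<in> alg_G I" and g': "g' \<in> alg_G I" using f g by (auto simp: is_G_deriv_iff)
  have "AE x in lebesgue. x \<in> U \<longrightarrow> f' x + (-1) * g' x = 0"
  proof (rule alg_G_zero_on[OF U])
    show "(\<lambda>x. f' x + (-1) * g' x) \<in> alg_G I"
      using f' g' by (intro fun_subspace_add fun_subspace_scale fun_subspace_alg_G)
    fix t F assume t: "t \<in> U" and F: "F \<in> ess_sides t"
    then have tI: "t \<in> I" using U by auto
    have "((\<lambda>s. (g s - Lim F g) / of_real (s - t)) \<longlongrightarrow> Lim F f') F"
      using is_G_deriv_cong[OF U fg f t F] .
    moreover have "((\<lambda>s. (g s - Lim F g) / of_real (s - t)) \<longlongrightarrow> Lim F g') F"
      using g tI F by (auto simp: is_G_deriv_iff)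
    ultimately have "Lim F f' = Lim F g'"
      using tendsto_unique ess_sides_nontrivial[OF F] by blast
    moreover have "Lim F (\<lambda>x. f' x + (-1) * g' x) = Lim F f' + Lim F (\<lambda>x. (-1) * g' x)"
      using f' g' tI F by (intro ess_Lim_add fun_subspace_scale fun_subspace_alg_G)
    moreover have "Lim F (\<lambda>x. (-1) * g' x) = (-1) * Lim F g'"
      using g' tI F by (rule ess_Lim_cmult)
    ultimately show "Lim F (\<lambda>x. f' x + (-1) * g' x) = 0" by simp
  qed
  then show ?thesis by (auto elim: eventually_mono)
qed

lemma is_G_deriv_G_deriv: "g \<in> alg_G_inf I \<Longrightarrow> is_G_deriv I (G_deriv I k g) (G_deriv I (Suc k) g)"
  using someI_ex[of "is_G_deriv I (G_deriv I k g)"] by (simp add: alg_G_inf_def)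

lemma G_deriv_in_alg_G: "g \<in> alg_G_inf I \<Longrightarrow> G_deriv I k g \<in> alg_G I"
  using is_G_deriv_G_deriv[of g I] by (cases k) (auto simp: is_G_deriv_iff alg_G_inf_def)

text \<open>\<open>G_deriv\<close> is picked by \<open>SOME\<close>, so it can be identified only up
  to null sets; any explicit chain \<open>H\<close> of successive derivatives does this.\<close>

lemma
  assumes I: "open I" and g: "g \<in> alg_G I" "H 0 = g" and H: "\<And>k. is_G_deriv I (H k) (H (Suc k))"
  shows alg_G_infI: "g \<in> alg_G_inf I"
    and G_deriv_eqI: "AE x in lebesgue. x \<in> I \<longrightarrow> G_deriv I k g x = H k x"
proof -
  \<comment> \<open>\<open>H (Suc k)\<close> is also a derivative of the chosen function of order
    \<open>k\<close>, which agrees with \<open>H k\<close> almost everywhere. Hence the next choice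
    has a witness.\<close>
  have *: "is_G_deriv I (G_deriv I k g) (H (Suc k))"
    if "AE x in lebesgue. x \<in> I \<longrightarrow> G_deriv I k g x = H k x" for k
  proof -
    have "AE x in lebesgue. x \<in> I \<longrightarrow> H k x = G_deriv I k g x" using that by (auto elim: eventually_mono)
    then show ?thesis
      unfolding is_G_deriv_iff[of I "G_deriv I k g"]
      using H[of k] is_G_deriv_cong[OF I subset_refl _ H[of k]] by (auto simp: is_G_deriv_iff)
  qed
  show **: "AE x in lebesgue. x \<in> I \<longrightarrow> G_deriv I k g x = H k x" for k
  proof (induction k)
    case (Suc k)
    have "is_G_deriv I (G_deriv I k g) (G_deriv I (Suc k) g)"
      using someI[of "is_G_deriv I (G_deriv I k g)", OF *[OF Suc.IH]] by simp
    then show ?case using is_G_deriv_unique[OF I subset_refl _ _ *[OF Suc.IH]] by auto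
  qed (use g in auto)
  show "g \<in> alg_G_inf I"
    unfolding alg_G_inf_def using g *[OF **] by blast
qed

lemma
  assumes I: "open I" and f: "f \<in> alg_G_inf I" and g: "g \<in> alg_G_inf I"
  shows alg_G_inf_add: "(\<lambda>x. f x + g x) \<in> alg_G_inf I"
    and G_deriv_add: "AE x in lebesgue. x \<in> I \<longrightarrow>
      G_deriv I k (\<lambda>x. f x + g x) x = G_deriv I k f x + G_deriv I k g x"
proof -
  have "(\<lambda>x. f x + g x) \<in> alg_G I"
    using f g by (intro fun_subspace_add fun_subspace_alg_G) (auto simp: alg_G_inf_def)
  moreover have "is_G_deriv I (\<lambda>x. G_deriv I k f x + G_deriv I k g x)
      (\<lambda>x. G_deriv I (Suc k) f x + G_deriv I (Suc k) g x)" for k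
    using f g by (intro is_G_deriv_add G_deriv_in_alg_G is_G_deriv_G_deriv)
  ultimately show "(\<lambda>x. f x + g x) \<in> alg_G_inf I"
    "AE x in lebesgue. x \<in> I \<longrightarrow> G_deriv I k (\<lambda>x. f x + g x) x = G_deriv I k f x + G_deriv I k g x"
    using alg_G_infI[OF I, of _ "\<lambda>k x. G_deriv I k f x + G_deriv I k g x"]
      G_deriv_eqI[OF I, of _ "\<lambda>k x. G_deriv I k f x + G_deriv I k g x"] by simp_all
qed

lemma
  assumes I: "open I" and f: "f \<in> alg_G_inf I"
  shows alg_G_inf_cmult: "(\<lambda>x. c * f x) \<in> alg_G_inf I"
    and G_deriv_cmult: "AE x in lebesgue. x \<in> I \<longrightarrow> G_deriv I k (\<lambda>x. c * f x) x = c * G_deriv I k f x"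
proof -
  have "(\<lambda>x. c * f x) \<in> alg_G I"
    using f by (intro fun_subspace_scale fun_subspace_alg_G) (auto simp: alg_G_inf_def)
  moreover have "is_G_deriv I (\<lambda>x. c * G_deriv I k f x) (\<lambda>x. c * G_deriv I (Suc k) f x)" for k
    using f by (intro is_G_deriv_cmult G_deriv_in_alg_G is_G_deriv_G_deriv)
  ultimately show "(\<lambda>x. c * f x) \<in> alg_G_inf I"
    "AE x in lebesgue. x \<in> I \<longrightarrow> G_deriv I k (\<lambda>x. c * f x) x = c * G_deriv I k f x"
    using alg_G_infI[OF I, of _ "\<lambda>k x. c * G_deriv I k f x"]
      G_deriv_eqI[OF I, of _ "\<lambda>k x. c * G_deriv I k f x"] by simp_all
qed

lemma has_vector_derivative_imp_tendsto:
  fixes f :: "real \<Rightarrow> complex"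
  assumes "(f has_vector_derivative D) (at t)"
  shows "((\<lambda>s. (f s - f t) / of_real (s - t)) \<longlongrightarrow> D) (at t)"
proof -
  have "((\<lambda>s. norm (((f s - f t) - (s - t) *\<^sub>R D) /\<^sub>R norm (s - t))) \<longlongrightarrow> 0) (at t)"
    using assms unfolding has_vector_derivative_def has_derivative_at_within by (intro tendsto_norm_zero) simp
  moreover have "eventually (\<lambda>s. norm (((f s - f t) - (s - t) *\<^sub>R D) /\<^sub>R norm (s - t)) =
      norm ((f s - f t) / of_real (s - t) - D)) (at t)"
    unfolding eventually_at_filter
  proof (intro always_eventually allI impI)
    fix s assume "s \<noteq> t"
    then have "(f s - f t) / of_real (s - t) - D = ((f s - f t) - (s - t) *\<^sub>R D) / of_real (s - t)"
      by (simp add: diff_divide_distrib scaleR_conv_of_real)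
    then show "norm (((f s - f t) - (s - t) *\<^sub>R D) /\<^sub>R norm (s - t)) = norm ((f s - f t) / of_real (s - t) - D)"
      by (simp only: norm_divide norm_scaleR norm_of_real abs_inverse abs_abs real_norm_def) (simp add: field_simps)
  qed
  ultimately have "((\<lambda>s. norm ((f s - f t) / of_real (s - t) - D)) \<longlongrightarrow> 0) (at t)"
    by (rule Lim_transform_eventually)
  then show ?thesis by (simp add: tendsto_norm_zero_iff LIM_zero_iff)
qed

text \<open>The classical derivatives form a chain as required by \<open>alg_G_infI\<close>: limits
  at \<open>t\<close> restrict to both one-sided essential filters, and compact support gives
  boundedness.\<close>

lemma
  assumes I: "open I" and K: "compact K" "f \<in> space_D_step K"
  shows space_D_step_in_alg_G_inf: "f \<in> alg_G_inf I"
    and G_deriv_smooth: "AE x in lebesgue. x \<in> I \<longrightarrow> G_deriv I k f x = nth_deriv k f x"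
proof -
  have f: "smooth f" using K by (simp add: space_D_step_iff)
  have tends: "(nth_deriv k f \<longlongrightarrow> nth_deriv k f t) F" if "F \<in> ess_sides t" for k t F
    using smooth_continuous[OF f, of t k] ess_sides_le_at[OF that] by (auto simp: isCont_def intro: tendsto_mono)
  then have lim: "Lim F (nth_deriv k f) = nth_deriv k f t" if "F \<in> ess_sides t" for k t F
    using that ess_Lim_eqI by blast
  have G: "nth_deriv k f \<in> alg_G I" for k
  proof -
    obtain B where "\<And>x. norm (nth_deriv k f x) \<le> B" using nth_deriv_bounded[OF K, of k] by blast
    moreover have "nth_deriv k f \<in> borel_measurable (lebesgue_on I)"
      using smooth_continuous[OF f] I
      by (intro continuous_imp_measurable_on_sets_lebesgue) (auto intro: continuous_at_imp_continuous_on)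
    ultimately show ?thesis using tends lim by (auto simp: alg_G_iff ess_bounded_def)
  qed
  have "is_G_deriv I (nth_deriv k f) (nth_deriv (Suc k) f)" for k
    unfolding is_G_deriv_iff
  proof (intro conjI ballI G)
    fix t F assume F: "F \<in> ess_sides t"
    have "((\<lambda>s. (nth_deriv k f s - nth_deriv k f t) / of_real (s - t)) \<longlongrightarrow> nth_deriv (Suc k) f t) (at t)"
      by (rule has_vector_derivative_imp_tendsto[OF smooth_has_vector_derivative[OF f]])
    then show "((\<lambda>s. (nth_deriv k f s - Lim F (nth_deriv k f)) / of_real (s - t)) \<longlongrightarrow>
        Lim F (nth_deriv (Suc k) f)) F"
      unfolding lim[OF F] using ess_sides_le_at[OF F] by (rule tendsto_mono[rotated])
  qed
  then show "f \<in> alg_G_inf I" "AE x in lebesgue. x \<in> I \<longrightarrow> G_deriv I k f x = nth_deriv k f x"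
    using alg_G_infI[OF I, of f "\<lambda>k. nth_deriv k f"] G_deriv_eqI[OF I, of f "\<lambda>k. nth_deriv k f"] G[of 0]
    by simp_all
qed

lemma fun_subspace_alg_G_inf:
  assumes "open I"
  shows "fun_subspace (alg_G_inf I)"
  unfolding fun_subspace_def
  using space_D_step_in_alg_G_inf[OF assms compact_empty fun_subspace_zero[OF fun_subspace_D_step]]
    alg_G_inf_add[OF assms] alg_G_inf_cmult[OF assms] by blast

text \<open>Induction on the order, comparing with the zero function, which is its own
  derivative.\<close>

lemma G_deriv_zero_on:
  assumes I: "open I" and U: "open U" "U \<subseteq> I" and f: "f \<in> alg_G_inf I" "AE x in lebesgue. x \<in> U \<longrightarrow> f x = 0"
  shows "AE x in lebesgue. x \<in> U \<longrightarrow> G_deriv I k f x = 0"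
proof (induction k)
  case (Suc k)
  have "is_G_deriv I (\<lambda>x. 0) (\<lambda>x. 0)"
    using fun_subspace_zero[OF fun_subspace_alg_G] by (auto simp: is_G_deriv_iff ess_Lim_eqI[where l = 0])
  from is_G_deriv_unique[OF U Suc.IH is_G_deriv_G_deriv[OF f(1)] this] show ?case .
qed (use f in auto)

section \<open>Localised norms\<close>

text \<open>The indicator is applied after differentiating, so no truncation of \<open>g\<close> is
  ever differentiated, and \<open>A = UNIV\<close> gives back \<open>G_norm\<close>.\<close>

definition G_norm_on :: "real set \<Rightarrow> real set \<Rightarrow> nat \<Rightarrow> (real \<Rightarrow> complex) \<Rightarrow> real" where
  "G_norm_on I A k g = Max ((\<lambda>i. Linf_norm I (\<lambda>x. indicator A x * G_deriv I i g x)) ` {..k})"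

lemma G_norm_on_UNIV: "G_norm_on I UNIV = G_norm I"
  by (simp add: fun_eq_iff G_norm_on_def G_norm_def)

lemma
  assumes I: "open I" and A: "open A" and g: "g \<in> alg_G_inf I"
  shows AE_le_G_norm_on: "i \<le> k \<Longrightarrow> AE x in lebesgue. x \<in> I \<inter> A \<longrightarrow> norm (G_deriv I i g x) \<le> G_norm_on I A k g"
    and G_norm_on_leI: "M \<ge> 0 \<Longrightarrow> (\<And>i. i \<le> k \<Longrightarrow>
      AE x in lebesgue. x \<in> I \<inter> A \<longrightarrow> norm (G_deriv I i g x) \<le> M) \<Longrightarrow> G_norm_on I A k g \<le> M"
    and G_norm_on_nonneg: "0 \<le> G_norm_on I A k g"
proof -
  have meas: "(\<lambda>x. indicator A x * G_deriv I i g x) \<in> borel_measurable (lebesgue_on I)" for i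
  proof -
    have "A \<inter> space (lebesgue_on I) \<in> sets (lebesgue_on I)"
      using A I by (auto simp: sets_restrict_space_iff)
    then have "(indicator A :: real \<Rightarrow> complex) \<in> borel_measurable (lebesgue_on I)"
      by (subst borel_measurable_indicator_iff) simp
    moreover have "G_deriv I i g \<in> borel_measurable (lebesgue_on I)"
      using G_deriv_in_alg_G[OF g, of i] by (simp add: alg_G_def)
    ultimately show ?thesis by simp
  qed
  have bdd: "(\<lambda>x. indicator A x * G_deriv I i g x) \<in> ess_bounded I" for i
  proof -
    obtain C where C: "AE x in lebesgue_on I. norm (G_deriv I i g x) \<le> C"
      using G_deriv_in_alg_G[OF g, of i] by (auto simp: alg_G_def)
    then have "AE x in lebesgue_on I. norm (indicator A x * G_deriv I i g x) \<le> C"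
    proof eventually_elim
      case (elim x)
      then show ?case using norm_ge_zero[of "G_deriv I i g x"]
        by (cases "x \<in> A") (simp, simp del: norm_ge_zero)
    qed
    then show ?thesis using meas by (auto simp: ess_bounded_def)
  qed
  show "AE x in lebesgue. x \<in> I \<inter> A \<longrightarrow> norm (G_deriv I i g x) \<le> G_norm_on I A k g" if "i \<le> k"
  proof -
    have le: "Linf_norm I (\<lambda>x. indicator A x * G_deriv I i g x) \<le> G_norm_on I A k g"
      unfolding G_norm_on_def using that by (intro Max_ge) auto
    have "AE x in lebesgue. x \<in> I \<longrightarrow> norm (indicator A x * G_deriv I i g x) \<le>
        Linf_norm I (\<lambda>x. indicator A x * G_deriv I i g x)"
      using AE_le_Linf_norm[OF bdd[of i]] unfolding AE_lebesgue_on_open[OF I] .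
    then show ?thesis by eventually_elim (use le in auto)
  qed
  show "G_norm_on I A k g \<le> M" if "M \<ge> 0"
    "\<And>i. i \<le> k \<Longrightarrow> AE x in lebesgue. x \<in> I \<inter> A \<longrightarrow> norm (G_deriv I i g x) \<le> M"
  proof -
    have "Linf_norm I (\<lambda>x. indicator A x * G_deriv I i g x) \<le> M" if "i \<le> k" for i
    proof (rule Linf_norm_leI[OF meas _ \<open>M \<ge> 0\<close>])
      have "AE x in lebesgue. x \<in> I \<longrightarrow> norm (indicator A x * G_deriv I i g x) \<le> M"
        using \<open>\<And>i. i \<le> k \<Longrightarrow> AE x in lebesgue. x \<in> I \<inter> A \<longrightarrow> norm (G_deriv I i g x) \<le> M\<close>[OF that]
        by eventually_elim (use \<open>M \<ge> 0\<close> in \<open>auto simp: indicator_def\<close>)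
      then show "AE x in lebesgue_on I. norm (indicator A x * G_deriv I i g x) \<le> M"
        unfolding AE_lebesgue_on_open[OF I] .
    qed
    then show ?thesis unfolding G_norm_on_def by (intro Max.boundedI) auto
  qed
  show "0 \<le> G_norm_on I A k g"
  proof -
    have "Linf_norm I (\<lambda>x. indicator A x * G_deriv I k g x) \<le> G_norm_on I A k g"
      unfolding G_norm_on_def by (intro Max_ge) auto
    then show ?thesis using Linf_norm_nonneg order_trans by blast
  qed
qed

lemma G_norm_on_mono:
  assumes I: "open I" and A: "open A" "open B" "A \<subseteq> B" and g: "g \<in> alg_G_inf I" and "j \<le> k"
  shows "G_norm_on I A j g \<le> G_norm_on I B k g"
proof (rule G_norm_on_leI[OF I A(1) g G_norm_on_nonneg[OF I A(2) g]])
  fix i assume "i \<le> j"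
  then have "AE x in lebesgue. x \<in> I \<inter> B \<longrightarrow> norm (G_deriv I i g x) \<le> G_norm_on I B k g"
    using \<open>j \<le> k\<close> by (intro AE_le_G_norm_on[OF I A(2) g]) simp
  then show "AE x in lebesgue. x \<in> I \<inter> A \<longrightarrow> norm (G_deriv I i g x) \<le> G_norm_on I B k g"
    by eventually_elim (use A in auto)
qed

lemma fun_seminorm_on_G_norm_on:
  assumes I: "open I" and A: "open A"
  shows "fun_seminorm_on (alg_G_inf I) (G_norm_on I A k)"
proof -
  note nonneg = G_norm_on_nonneg[OF I A]
  note S = fun_subspace_alg_G_inf[OF I]
  have le: "G_norm_on I A k (\<lambda>x. c * f x) \<le> cmod c * G_norm_on I A k f" if f: "f \<in> alg_G_inf I" for c f
  proof (rule G_norm_on_leI[OF I A fun_subspace_scale[OF S f]])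
    show "0 \<le> cmod c * G_norm_on I A k f" using nonneg[OF f] by simp
    fix i assume "i \<le> k"
    from AE_le_G_norm_on[OF I A f this] G_deriv_cmult[OF I f, of i c]
    show "AE x in lebesgue. x \<in> I \<inter> A \<longrightarrow> norm (G_deriv I i (\<lambda>x. c * f x) x) \<le> cmod c * G_norm_on I A k f"
      by eventually_elim (auto simp: norm_mult intro: mult_left_mono)
  qed
  have "G_norm_on I A k (\<lambda>x. c * f x) = cmod c * G_norm_on I A k f" if f: "f \<in> alg_G_inf I" for c f
  proof (cases "c = 0")
    case True
    then show ?thesis using le[OF f, of c] nonneg[OF fun_subspace_scale[OF S f], of k c] by simp
  next
    case False
    have "G_norm_on I A k f \<le> cmod (1 / c) * G_norm_on I A k (\<lambda>x. c * f x)"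
      using le[OF fun_subspace_scale[OF S f], of "1 / c" c] False by simp
    then show ?thesis using le[OF f, of c] False by (simp add: norm_divide field_simps)
  qed
  moreover have "G_norm_on I A k (\<lambda>x. f x + g x) \<le> G_norm_on I A k f + G_norm_on I A k g"
    if f: "f \<in> alg_G_inf I" and g: "g \<in> alg_G_inf I" for f g
  proof (rule G_norm_on_leI[OF I A fun_subspace_add[OF S f g]])
    show "0 \<le> G_norm_on I A k f + G_norm_on I A k g" using nonneg[OF f] nonneg[OF g] by simp
    fix i assume i: "i \<le> k"
    from AE_le_G_norm_on[OF I A f i] AE_le_G_norm_on[OF I A g i] G_deriv_add[OF I f g, of i]
    show "AE x in lebesgue. x \<in> I \<inter> A \<longrightarrow>
        norm (G_deriv I i (\<lambda>x. f x + g x) x) \<le> G_norm_on I A k f + G_norm_on I A k g"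
      by eventually_elim (auto intro: norm_triangle_mono)
  qed
  ultimately show ?thesis using nonneg by (simp add: fun_seminorm_on_def)
qed

text \<open>The source of two properties of the dominating seminorm: on a given test function only
  finitely many terms are nonzero, and functions that vanish almost everywhere have seminorm
  0.\<close>

lemma G_norm_on_eq_0:
  assumes I: "open I" and A: "open A" and f: "f \<in> alg_G_inf I" "AE x in lebesgue. x \<in> I \<inter> A \<longrightarrow> f x = 0"
  shows "G_norm_on I A k f = 0"
proof (rule antisym[OF G_norm_on_leI[OF I A f(1)] G_norm_on_nonneg[OF I A f(1)]])
  show "AE x in lebesgue. x \<in> I \<inter> A \<longrightarrow> norm (G_deriv I i f x) \<le> 0" for i
    using G_deriv_zero_on[OF I _ _ f, of i] I A by auto
qed simp

lemma G_norm_le_D_norm: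
  assumes I: "open I" and K: "compact K" "f \<in> space_D_step K"
  shows "G_norm I k f \<le> D_norm k f"
proof -
  note f = space_D_step_in_alg_G_inf[OF I K]
  have "G_norm_on I UNIV k f \<le> D_norm k f"
  proof (rule G_norm_on_leI[OF I open_UNIV f D_norm_nonneg[OF K]])
    fix i assume "i \<le> k"
    then have "norm (nth_deriv i f x) \<le> D_norm k f" for x by (rule nth_deriv_le_D_norm[OF K])
    then show "AE x in lebesgue. x \<in> I \<inter> UNIV \<longrightarrow> norm (G_deriv I i f x) \<le> D_norm k f"
      using G_deriv_smooth[OF I K, of i] by (auto elim: eventually_mono)
  qed
  then show ?thesis by (simp add: G_norm_on_UNIV)
qed

text \<open>An almost everywhere bound on an open set passes to the point \<open>x\<close> by
  continuity, taking the limit along the nontrivial filter \<open>ess_at_right x\<close>.\<close>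

lemma nth_deriv_le_G_norm_on:
  assumes I: "open I" and A: "open A" and K: "compact K" "f \<in> space_D_step K"
    and i: "i \<le> k" and x: "x \<in> I \<inter> A"
  shows "norm (nth_deriv i f x) \<le> G_norm_on I A k f"
proof -
  have F: "ess_at_right x \<in> ess_sides x" by (simp add: ess_sides_def)
  have "AE x in lebesgue. x \<in> I \<inter> A \<longrightarrow> norm (nth_deriv i f x) \<le> G_norm_on I A k f"
    using AE_le_G_norm_on[OF I A space_D_step_in_alg_G_inf[OF I K] i] G_deriv_smooth[OF I K, of i]
    by eventually_elim auto
  note AE_imp_eventually_ess_sides[OF open_Int[OF I A] x this F]
  moreover have "((\<lambda>x. norm (nth_deriv i f x)) \<longlongrightarrow> norm (nth_deriv i f x)) (ess_at_right x)"
    using smooth_continuous[of f x i] K ess_sides_le_at[OF F]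
    by (intro tendsto_norm) (auto simp: isCont_def space_D_step_iff intro: tendsto_mono)
  ultimately show ?thesis
    using ess_sides_nontrivial[OF F] by (intro tendsto_upperbound)
qed


section \<open>Extension of distributions\<close>

lemma convex_einterval: "convex (einterval a b)"
proof -
  have "is_interval (einterval a b)"
    unfolding is_interval_1 einterval_def
    by auto (meson ereal_less_eq(3) le_less_trans less_le_trans)+
  then show ?thesis by (simp add: is_interval_convex_1)
qed

text \<open>Convex hulls of an arbitrary compact exhaustion; they stay in \<open>I\<close> because
  \<open>I\<close> is convex. Convexity is what \<open>smooth_cutoff\<close> asks for.\<close>

lemma convex_compact_exhaustion:
  fixes I :: "real set"
  assumes "open I" "convex I"
  obtains K :: "nat \<Rightarrow> real set" where "\<And>n. compact (K n)" "\<And>n. convex (K n)" "\<And>n. K n \<subseteq> I"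
    "\<And>n. K n \<subseteq> K (Suc n)" "\<And>C. compact C \<Longrightarrow> C \<subseteq> I \<Longrightarrow> \<exists>N. \<forall>n\<ge>N. C \<subseteq> K n"
proof -
  obtain C :: "nat \<Rightarrow> real set" where C: "\<And>n. compact (C n)" "\<And>n. C n \<subseteq> I" "\<And>n. C n \<subseteq> interior (C (Suc n))"
    "\<And>K. compact K \<Longrightarrow> K \<subseteq> I \<Longrightarrow> \<exists>N. \<forall>n\<ge>N. K \<subseteq> C n"
    using open_Union_compact_subsets[OF assms(1)] by metis
  show thesis
  proof (rule that[of "\<lambda>n. convex hull (C n)"])
    show "compact (convex hull C n)" for n using C(1) by (rule compact_convex_hull)
    show "convex hull C n \<subseteq> I" for n using C(2) assms(2) by (rule hull_minimal)
    show "convex hull C n \<subseteq> convex hull C (Suc n)" for n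
      using C(3) interior_subset by (intro hull_mono) blast
    show "\<exists>N. \<forall>n\<ge>N. K \<subseteq> convex hull C n" if "compact K" "K \<subseteq> I" for K
      using C(4)[OF that] by (meson hull_subset subset_trans)
  qed simp
qed

text \<open>The functions are successive differences of cutoffs for an exhaustion, so their partial
  sums telescope to a single cutoff.\<close>

lemma smooth_partition:
  fixes I :: "real set"
  assumes I: "open I" "convex I"
  obtains \<eta> :: "nat \<Rightarrow> real \<Rightarrow> complex" and L A :: "nat \<Rightarrow> real set"
  where "\<And>n. compact (L n)" "\<And>n. L n \<subseteq> I" "\<And>n. \<eta> n \<in> space_D_step (L n)" "\<And>n. open (A n)"
    "\<And>n i x. x \<notin> A n \<Longrightarrow> nth_deriv i (\<eta> n) x = 0"
    "\<And>C. compact C \<Longrightarrow> C \<subseteq> I \<Longrightarrow> \<exists>N. (\<forall>n>N. A n \<inter> C = {}) \<and> (\<forall>x\<in>C. (\<Sum>n\<le>N. \<eta> n x) = 1)"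
proof -
  obtain K where K: "\<And>n. compact (K n)" "\<And>n. convex (K n)" "\<And>n. K n \<subseteq> I"
    "\<And>n. K n \<subseteq> K (Suc n)" "\<And>C. compact C \<Longrightarrow> C \<subseteq> I \<Longrightarrow> \<exists>N. \<forall>n\<ge>N. C \<subseteq> K n"
    using convex_compact_exhaustion[OF I] by metis
  have "\<exists>\<psi> U L. smooth \<psi> \<and> open U \<and> K n \<subseteq> U \<and> (\<forall>x\<in>U. \<psi> x = 1) \<and> compact L \<and> L \<subseteq> I \<and>
      (\<forall>x. x \<notin> L \<longrightarrow> \<psi> x = 0)" for n
    using smooth_cutoff[OF I(1) K(1)[of n] K(2)[of n] K(3)[of n]] by metis
  then obtain \<psi> U L where \<psi>: "\<And>n. smooth (\<psi> n)" "\<And>n. open (U n)" "\<And>n. K n \<subseteq> U n"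
    "\<And>n x. x \<in> U n \<Longrightarrow> \<psi> n x = 1" and L: "\<And>n. compact (L n)" "\<And>n. L n \<subseteq> I"
    "\<And>n x. x \<notin> L n \<Longrightarrow> \<psi> n x = 0" by metis
  define \<eta> where "\<eta> n = (case n of 0 \<Rightarrow> \<psi> 0 | Suc m \<Rightarrow> (\<lambda>x. \<psi> (Suc m) x - \<psi> m x))" for n
  define L' where "L' n = (case n of 0 \<Rightarrow> L 0 | Suc m \<Rightarrow> L (Suc m) \<union> L m)" for n
  \<comment> \<open>Both cutoffs in the difference with index \<open>Suc m\<close> equal 1 near
    \<open>K m\<close>, so only the complement of \<open>K m\<close> is relevant.\<close>
  define A where "A n = (case n of 0 \<Rightarrow> UNIV | Suc m \<Rightarrow> - K m)" for n
  have sum: "(\<Sum>n\<le>N. \<eta> n x) = \<psi> N x" for N x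
    by (induction N) (auto simp: \<eta>_def)
  show thesis
  proof (rule that[of L' \<eta> A])
    show "compact (L' n)" for n using L(1) by (auto simp: L'_def split: nat.splits)
    show "L' n \<subseteq> I" for n using L(2) by (auto simp: L'_def split: nat.splits)
    show "open (A n)" for n using K(1) compact_imp_closed by (auto simp: A_def split: nat.splits)
    show "\<eta> n \<in> space_D_step (L' n)" for n
      using \<psi>(1) L(3) smooth_diff
      by (auto simp: \<eta>_def L'_def space_D_step_iff split: nat.splits)
    show "nth_deriv i (\<eta> n) x = 0" if x: "x \<notin> A n" for n i x
    proof (cases n)
      case 0 then show ?thesis using x by (simp add: A_def)
    next
      case (Suc m)
      then have "x \<in> K m" using x by (simp add: A_def)
      \<comment> \<open>\<open>K m\<close> lies in \<open>K (Suc m)\<close>, so both cutoffs are 1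
        on one open set around \<open>x\<close>.\<close>
      then have "x \<in> U m \<inter> U (Suc m)" using \<psi>(3) K(4) by blast
      moreover have "\<eta> n y = 0" if "y \<in> U m \<inter> U (Suc m)" for y
        using that \<psi>(4) by (simp add: \<eta>_def Suc)
      ultimately show ?thesis using \<psi>(2) by (intro nth_deriv_zero_on_open[of "U m \<inter> U (Suc m)"]) auto
    qed
    show "\<exists>N. (\<forall>n>N. A n \<inter> C = {}) \<and> (\<forall>x\<in>C. (\<Sum>n\<le>N. \<eta> n x) = 1)" if C: "compact C" "C \<subseteq> I" for C
    proof -
      obtain N where N: "\<And>n. n \<ge> N \<Longrightarrow> C \<subseteq> K n" using K(5)[OF C] by blast
      \<comment> \<open>The index shifts by one: \<open>A n\<close> is the complement of
        \<open>K (n - 1)\<close>, hence the strict inequality.\<close>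
      have "A n \<inter> C = {}" if "n > N" for n
        using that N[of "n - 1"] by (cases n) (auto simp: A_def)
      moreover have "(\<Sum>n\<le>N. \<eta> n x) = 1" if "x \<in> C" for x
        unfolding sum using that N[of N] \<psi>(3)[of N] \<psi>(4) by blast
      ultimately show ?thesis by blast
    qed
  qed
qed

section \<open>The steps of \<R> and the inclusion of \<D>\<close>

lemma space_R_iff:
  assumes "open I"
  shows "f \<in> space_R I \<longleftrightarrow> f \<in> alg_G_inf I \<and>
    (\<exists>K. compact K \<and> K \<subseteq> I \<and> (AE x in lebesgue. x \<in> I - K \<longrightarrow> f x = 0))"
  by (simp add: space_R_def AE_lebesgue_on_open[OF assms] imp_conjL)

lemma space_R_step_iff:
  assumes "open I"
  shows "f \<in> space_R_step I J \<longleftrightarrow> f \<in> alg_G_inf I \<and> (AE x in lebesgue. x \<in> I - J \<longrightarrow> f x = 0)"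
  by (simp add: space_R_step_def AE_lebesgue_on_open[OF assms] imp_conjL)

lemma fun_subspace_R_step:
  assumes I: "open I"
  shows "fun_subspace (space_R_step I J)"
  unfolding fun_subspace_def
proof (intro conjI ballI allI)
  note S = fun_subspace_alg_G_inf[OF I]
  show "(\<lambda>x. 0) \<in> space_R_step I J" using fun_subspace_zero[OF S] by (simp add: space_R_step_iff[OF I])
  fix f assume "f \<in> space_R_step I J"
  then have f: "f \<in> alg_G_inf I" "AE x in lebesgue. x \<in> I - J \<longrightarrow> f x = 0" by (auto simp: space_R_step_iff[OF I])
  then show "(\<lambda>x. c * f x) \<in> space_R_step I J" for c
    using fun_subspace_scale[OF S] by (auto simp: space_R_step_iff[OF I] elim: eventually_mono)
  fix g assume "g \<in> space_R_step I J"
  then have g: "g \<in> alg_G_inf I" "AE x in lebesgue. x \<in> I - J \<longrightarrow> g x = 0" by (auto simp: space_R_step_iff[OF I])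
  have "AE x in lebesgue. x \<in> I - J \<longrightarrow> f x + g x = 0"
    using f(2) g(2) by eventually_elim auto
  then show "(\<lambda>x. f x + g x) \<in> space_R_step I J"
    using fun_subspace_add[OF S f(1) g(1)] by (simp add: space_R_step_iff[OF I])
qed

lemma space_R_step_mono: "open I \<Longrightarrow> J \<subseteq> J' \<Longrightarrow> space_R_step I J \<subseteq> space_R_step I J'"
  by (auto simp: space_R_step_iff elim!: eventually_mono)

text \<open>All compact sets are used here, not only intervals, so that two steps lie in the step of
  the union; closure under addition follows.\<close>

lemma space_R_eq: "open I \<Longrightarrow> space_R I = (\<Union>K\<in>{K. compact K \<and> K \<subseteq> I}. space_R_step I K)"
  by (auto simp: space_R_iff space_R_step_iff)

lemma fun_subspace_R:
  assumes I: "open I"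
  shows "fun_subspace (space_R I)"
  unfolding fun_subspace_def
proof (intro conjI ballI allI)
  note S = fun_subspace_R_step[OF I]
  show "(\<lambda>x. 0) \<in> space_R I"
    using fun_subspace_zero[OF S, of "{}"] by (auto simp: space_R_eq[OF I])
  show "(\<lambda>x. c * f x) \<in> space_R I" if "f \<in> space_R I" for c f
    using that fun_subspace_scale[OF S] by (auto simp: space_R_eq[OF I])
  fix f g assume "f \<in> space_R I" "g \<in> space_R I"
  then obtain K L where K: "compact K" "K \<subseteq> I" "f \<in> space_R_step I K"
    and L: "compact L" "L \<subseteq> I" "g \<in> space_R_step I L" by (auto simp: space_R_eq[OF I])
  then have "f \<in> space_R_step I (K \<union> L)" "g \<in> space_R_step I (K \<union> L)"
    using space_R_step_mono[OF I, of K "K \<union> L"] space_R_step_mono[OF I, of L "K \<union> L"] by auto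
  then have "(\<lambda>x. f x + g x) \<in> space_R_step I (K \<union> L)" using fun_subspace_add S by blast
  then show "(\<lambda>x. f x + g x) \<in> space_R I"
    unfolding space_R_eq[OF I] using K L by (intro UN_I[of "K \<union> L"]) auto
qed

lemma space_R_step_subset:
  assumes I: "open I" and J: "bounded J" "closure J \<subseteq> I"
  shows "space_R_step I J \<subseteq> space_R I"
  using space_R_step_mono[OF I closure_subset, of J] J compact_closure[of J]
  unfolding space_R_eq[OF I] by blast

lemma space_D_step_subset_R_step:
  assumes I: "open I" and K: "compact K" "K \<subseteq> J"
  shows "space_D_step K \<subseteq> space_R_step I J"
proof
  fix f assume f: "f \<in> space_D_step K"
  then have "x \<in> I - J \<longrightarrow> f x = 0" for x using K by (auto simp: space_D_step_iff)
  then show "f \<in> space_R_step I J"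
    using space_D_step_in_alg_G_inf[OF I K(1) f] by (simp add: space_R_step_iff[OF I])
qed

lemma space_D_subset_R: "open I \<Longrightarrow> space_D I \<subseteq> space_R I"
  using space_D_step_subset_R_step by (fastforce simp: space_D_def space_R_eq)

lemma space_R_step_subset_alg_G_inf: "open I \<Longrightarrow> space_R_step I J \<subseteq> alg_G_inf I"
  and space_R_subset_alg_G_inf: "open I \<Longrightarrow> space_R I \<subseteq> alg_G_inf I"
  by (auto simp: space_R_step_iff space_R_iff)

lemma fun_seminorm_on_G_norm: "open I \<Longrightarrow> fun_seminorm_on (alg_G_inf I) (G_norm I k)"
  using fun_seminorm_on_G_norm_on[of I UNIV k] by (simp add: G_norm_on_UNIV)

lemma continuous_dual_iff:
  "F \<in> continuous_dual V X \<longleftrightarrow> F \<in> extensional V \<and> fun_linear_on V F \<and> continuous_map X euclidean F"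
  by (auto simp: continuous_dual_def fun_linear_on_def)

section \<open>Continuity as boundedness on the steps, and restrictions of functionals\<close>

lemma continuous_map_topology_R_iff:
  assumes I: "open I" and F: "fun_linear_on (space_R I) F"
  shows "continuous_map (topology_R I) euclidean F \<longleftrightarrow>
    (\<forall>J. is_interval J \<and> bounded J \<and> closure J \<subseteq> I \<longrightarrow>
      (\<exists>k C. \<forall>f\<in>space_R_step I J. cmod (F f) \<le> C * G_norm I k f))"
proof -
  note S = fun_subspace_R_step[OF I]
  have p: "fun_seminorm_on (space_R_step I J) (G_norm I k)" for J k
    using fun_seminorm_on_subset[OF fun_seminorm_on_G_norm space_R_step_subset_alg_G_inf] I by blast
  have mono: "G_norm I j f \<le> G_norm I k f" if "j \<le> k" "f \<in> space_R_step I J" for j k f J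
    using G_norm_on_mono[OF I open_UNIV open_UNIV subset_refl, of f j k] space_R_step_subset_alg_G_inf[OF I] that
    by (auto simp: G_norm_on_UNIV)
  have step: "continuous_map (countably_normed_topology (space_R_step I J) (G_norm I)) euclidean F \<longleftrightarrow>
      (\<exists>k C. \<forall>f\<in>space_R_step I J. cmod (F f) \<le> C * G_norm I k f)"
    if "bounded J" "closure J \<subseteq> I" for J
    by (intro continuous_map_countably_normed_iff[OF S p mono] fun_linear_on_subset[OF F]
        space_R_step_subset I that)
  have "continuous_map (topology_R I) euclidean F \<longleftrightarrow>
      (\<forall>Y\<in>{countably_normed_topology (space_R_step I J) (G_norm I) | J.
        is_interval J \<and> bounded J \<and> closure J \<subseteq> I}. continuous_map Y euclidean F)"
    unfolding topology_R_def
    by (rule continuous_map_lc_inductive_limit_iff[OF fun_subspace_R[OF I] F])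
      (use topspace_countably_normed[of _ "G_norm I", OF S p] space_R_step_subset[OF I] in auto)
  then show ?thesis using step by auto
qed

lemma continuous_map_topology_D_iff:
  assumes F: "fun_linear_on (space_D I) F"
  shows "continuous_map (topology_D I) euclidean F \<longleftrightarrow>
    (\<forall>K. compact K \<and> K \<subseteq> I \<longrightarrow> (\<exists>k C. \<forall>f\<in>space_D_step K. cmod (F f) \<le> C * D_norm k f))"
proof -
  note S = fun_subspace_D_step
  have sub: "space_D_step K \<subseteq> space_D I" if "compact K" "K \<subseteq> I" for K
    using that by (auto simp: space_D_def)
  have step: "continuous_map (countably_normed_topology (space_D_step K) D_norm) euclidean F \<longleftrightarrow>
      (\<exists>k C. \<forall>f\<in>space_D_step K. cmod (F f) \<le> C * D_norm k f)"
    if "compact K" "K \<subseteq> I" for K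
    using that
    by (intro continuous_map_countably_normed_iff[OF S fun_seminorm_on_D_norm]
        fun_linear_on_subset[OF F sub] D_norm_mono[of K])
  have "continuous_map (topology_D I) euclidean F \<longleftrightarrow>
      (\<forall>Y\<in>{countably_normed_topology (space_D_step K) D_norm | K. compact K \<and> K \<subseteq> I}.
        continuous_map Y euclidean F)"
    unfolding topology_D_def
    by (rule continuous_map_lc_inductive_limit_iff[OF fun_subspace_D F])
      (use topspace_countably_normed[of _ D_norm, OF S fun_seminorm_on_D_norm] sub in auto)
  then show ?thesis using step by auto
qed

lemma restriction_op_in_dual_D:
  assumes I: "open I" "convex I" and F: "F \<in> dual_R I"
  shows "restriction_op I F \<in> dual_D I"
proof -
  have FR: "fun_linear_on (space_R I) F" "continuous_map (topology_R I) euclidean F"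
    using F by (auto simp: dual_R_def continuous_dual_iff)
  have "fun_linear_on (space_D I) F"
    using fun_linear_on_subset[OF FR(1) space_D_subset_R[OF I(1)]] .
  then have lin: "fun_linear_on (space_D I) (restriction_op I F)"
    using fun_subspace_add[OF fun_subspace_D, of _ I] fun_subspace_scale[OF fun_subspace_D, of _ I]
    by (simp add: fun_linear_on_def restriction_op_def)
  have "\<exists>k C. \<forall>f\<in>space_D_step K. cmod (restriction_op I F f) \<le> C * D_norm k f"
    if K: "compact K" "K \<subseteq> I" for K
  proof -
    \<comment> \<open>The steps of \<D> are indexed by compact sets, those in the topology of \<R>
      by intervals.\<close>
    let ?J = "convex hull K"
    have J: "compact ?J" "?J \<subseteq> I" "is_interval ?J"
      using K I by (auto simp: compact_convex_hull hull_minimal is_interval_convex_1)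
    then have "\<exists>k C. \<forall>f\<in>space_R_step I ?J. cmod (F f) \<le> C * G_norm I k f"
      using FR continuous_map_topology_R_iff[OF I(1) FR(1)] by (simp add: compact_imp_bounded compact_imp_closed)
    then obtain k C where C: "\<And>f. f \<in> space_R_step I ?J \<Longrightarrow> cmod (F f) \<le> C * G_norm I k f" by blast
    have "cmod (restriction_op I F f) \<le> \<bar>C\<bar> * D_norm k f" if f: "f \<in> space_D_step K" for f
    proof -
      have fR: "f \<in> space_R_step I ?J"
        using space_D_step_subset_R_step[OF I(1) K(1) hull_subset] f by blast
      have fG: "f \<in> alg_G_inf I" using space_D_step_in_alg_G_inf[OF I(1) K(1) f] .
      have "f \<in> space_D I" using K f by (auto simp: space_D_def)
      then have "cmod (restriction_op I F f) = cmod (F f)" by (simp add: restriction_op_def)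
      also have "\<dots> \<le> C * G_norm I k f" using C[OF fR] .
      also have "\<dots> \<le> \<bar>C\<bar> * G_norm I k f"
        using fun_seminorm_on_nonneg[OF fun_seminorm_on_G_norm[OF I(1)] fG] by (intro mult_right_mono) auto
      also have "\<dots> \<le> \<bar>C\<bar> * D_norm k f" using G_norm_le_D_norm[OF I(1) K(1) f] by (intro mult_left_mono) auto
      finally show ?thesis .
    qed
    then show ?thesis by blast
  qed
  then show ?thesis
    using lin continuous_map_topology_D_iff[OF lin]
    by (simp add: dual_D_def continuous_dual_iff restriction_op_def)
qed

section \<open>A locally finite dominating seminorm and the extension\<close>

text \<open>For fixed \<open>n\<close> all products \<open>\<eta> n * f\<close> lie in one step,
  that of \<open>L n\<close>, so the order \<open>k n\<close> and the constant \<open>c n\<close> do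
  not depend on \<open>f\<close>. Only the number \<open>N\<close> of terms does.\<close>

lemma distribution_dominated:
  assumes I: "open I" "convex I" and T: "fun_linear_on (space_D I) T"
    and cont: "continuous_map (topology_D I) euclidean T"
  shows "\<exists>(c :: nat \<Rightarrow> real) (k :: nat \<Rightarrow> nat) (A :: nat \<Rightarrow> real set). (\<forall>n. 0 \<le> c n) \<and> (\<forall>n. open (A n)) \<and>
    (\<forall>K. compact K \<and> K \<subseteq> I \<longrightarrow> (\<exists>N. \<forall>n>N. A n \<inter> K = {})) \<and>
    (\<forall>f\<in>space_D I. \<exists>N. cmod (T f) \<le> (\<Sum>n\<le>N. c n * G_norm_on I (A n) (k n) f))"
proof -
  obtain \<eta> :: "nat \<Rightarrow> real \<Rightarrow> complex" and L A :: "nat \<Rightarrow> real set" where L: "\<And>n. compact (L n)" "\<And>n. L n \<subseteq> I" "\<And>n. \<eta> n \<in> space_D_step (L n)"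
    and A: "\<And>n. open (A n)" "\<And>n i x. x \<notin> A n \<Longrightarrow> nth_deriv i (\<eta> n) x = 0"
      "\<And>C. compact C \<Longrightarrow> C \<subseteq> I \<Longrightarrow> \<exists>N. (\<forall>n>N. A n \<inter> C = {}) \<and> (\<forall>x\<in>C. (\<Sum>n\<le>N. \<eta> n x) = 1)"
    using smooth_partition[OF I] by metis
  have "\<exists>c k. c \<ge> 0 \<and> (\<forall>f\<in>space_D I. (\<lambda>x. \<eta> n x * f x) \<in> space_D I \<and>
      cmod (T (\<lambda>x. \<eta> n x * f x)) \<le> c * G_norm_on I (A n) k f)" for n
  proof -
    obtain k C where C: "\<And>f. f \<in> space_D_step (L n) \<Longrightarrow> cmod (T f) \<le> C * D_norm k f"
      using cont[unfolded continuous_map_topology_D_iff[OF T], rule_format, OF conjI[OF L(1,2)]] by blast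
    \<comment> \<open>\<open>G_norm_on\<close> sees only points of \<open>I\<close>, so the
      derivatives of \<open>\<eta> n\<close> must also vanish off \<open>I\<close>; they do because
      \<open>L n\<close> lies inside \<open>I\<close>.\<close>
    have A': "\<And>i x. x \<notin> I \<inter> A n \<Longrightarrow> nth_deriv i (\<eta> n) x = 0"
      using A(2) nth_deriv_support[OF compact_imp_closed[OF L(1)] L(3)] L(2) by blast
    obtain B where B: "B \<ge> 0" "\<forall>f M. smooth f \<longrightarrow> 0 \<le> M \<longrightarrow>
        (\<forall>j\<le>k. \<forall>y\<in>I \<inter> A n. norm (nth_deriv j f y) \<le> M) \<longrightarrow>
        (\<forall>i\<le>k. \<forall>x. norm (nth_deriv i (\<lambda>x. \<eta> n x * f x) x) \<le> B * M)"
      using nth_deriv_mult_bound[OF L(1,3), where A = "I \<inter> A n" and k = k] A' by blast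
    have "(\<lambda>x. \<eta> n x * f x) \<in> space_D I \<and>
        cmod (T (\<lambda>x. \<eta> n x * f x)) \<le> \<bar>C\<bar> * B * G_norm_on I (A n) k f" if fD: "f \<in> space_D I" for f
    proof -
      obtain K where K: "compact K" "K \<subseteq> I" "f \<in> space_D_step K" using fD by (auto simp: space_D_def)
      then have f: "smooth f" by (simp add: space_D_step_iff)
      have \<eta>f: "(\<lambda>x. \<eta> n x * f x) \<in> space_D_step (L n)"
        using L(3)[of n] smooth_mult f by (auto simp: space_D_step_iff)
      let ?M = "G_norm_on I (A n) k f"
      have "0 \<le> ?M" using G_norm_on_nonneg[OF I(1) A(1) space_D_step_in_alg_G_inf[OF I(1) K(1,3)]] .
      moreover have "\<forall>j\<le>k. \<forall>y\<in>I \<inter> A n. norm (nth_deriv j f y) \<le> ?M"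
        using nth_deriv_le_G_norm_on[OF I(1) A(1) K(1,3)] by blast
      ultimately have "\<forall>i\<le>k. \<forall>x. norm (nth_deriv i (\<lambda>x. \<eta> n x * f x) x) \<le> B * ?M"
        using B(2) f by blast
      then have "D_norm k (\<lambda>x. \<eta> n x * f x) \<le> B * ?M"
        by (intro D_norm_leI[OF L(1) \<eta>f]) blast
      then have "cmod (T (\<lambda>x. \<eta> n x * f x)) \<le> \<bar>C\<bar> * (B * ?M)"
        using C[OF \<eta>f] D_norm_nonneg[OF L(1) \<eta>f, of k]
        by (meson abs_ge_self abs_ge_zero mult_left_mono mult_right_mono order_trans)
      then show ?thesis using \<eta>f L(1,2) by (auto simp: space_D_def mult.assoc)
    qed
    \<comment> \<open>\<open>C\<close> comes from the continuity of \<open>T\<close> on the step of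
      \<open>L n\<close>, and \<open>B\<close> from the Leibniz bound for
      \<open>\<eta> n\<close>.\<close>
    then show ?thesis using B(1) by (intro exI[of _ "\<bar>C\<bar> * B"] exI[of _ k]) auto
  qed
  then obtain c k where c: "\<And>n. c n \<ge> 0" "\<And>n f. f \<in> space_D I \<Longrightarrow> (\<lambda>x. \<eta> n x * f x) \<in> space_D I"
    "\<And>n f. f \<in> space_D I \<Longrightarrow> cmod (T (\<lambda>x. \<eta> n x * f x)) \<le> c n * G_norm_on I (A n) (k n) f"
    by metis
  have "\<exists>N. cmod (T f) \<le> (\<Sum>n\<le>N. c n * G_norm_on I (A n) (k n) f)" if f: "f \<in> space_D I" for f
  proof -
    obtain K where K: "compact K" "K \<subseteq> I" "f \<in> space_D_step K" using f by (auto simp: space_D_def)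
    obtain N where N: "\<And>x. x \<in> K \<Longrightarrow> (\<Sum>n\<le>N. \<eta> n x) = 1" using A(3)[OF K(1,2)] by blast
    have "f = (\<lambda>x. \<Sum>n\<le>N. \<eta> n x * f x)"
    proof
      show "f x = (\<Sum>n\<le>N. \<eta> n x * f x)" for x
        using N[of x] K(3) by (cases "x \<in> K") (auto simp: sum_distrib_right[symmetric] space_D_step_iff)
    qed
    then have "T f = T (\<lambda>x. \<Sum>n\<le>N. \<eta> n x * f x)" by simp
    also have "\<dots> = (\<Sum>n\<le>N. T (\<lambda>x. \<eta> n x * f x))"
      using fun_linear_on_sum[OF T fun_subspace_D, of "{..N}" "\<lambda>n x. \<eta> n x * f x"] c(2)[OF f] by simp
    finally have "cmod (T f) \<le> (\<Sum>n\<le>N. c n * G_norm_on I (A n) (k n) f)"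
      using c(3)[OF f] by (simp add: sum_norm_le)
    then show ?thesis by blast
  qed
  then show ?thesis using c(1) A(1,3) by (intro exI[of _ c] exI[of _ k] exI[of _ A]) blast
qed

text \<open>For each \<open>f\<close> the series is a finite sum; writing it as a series gives one
  formula although the number of terms varies with \<open>f\<close>.\<close>

lemma fun_seminorm_on_suminf:
  assumes V: "fun_subspace V" and c: "\<And>n. 0 \<le> c n" and q: "\<And>n. fun_seminorm_on V (q n)"
    and fin: "\<And>f. f \<in> V \<Longrightarrow> \<exists>N. \<forall>n>N. q n f = 0"
  shows "fun_seminorm_on V (\<lambda>f. \<Sum>n. c n * q n f)"
proof -
  have summable: "summable (\<lambda>n. c n * q n f)" if f: "f \<in> V" for f
  proof -
    obtain N where "\<forall>n>N. q n f = 0" using fin[OF f] by blast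
    then show ?thesis by (intro summable_finite[of "{..N}"]) auto
  qed
  show ?thesis unfolding fun_seminorm_on_def
  proof (intro conjI ballI allI)
    fix f assume f: "f \<in> V"
    show "0 \<le> (\<Sum>n. c n * q n f)"
      using c fun_seminorm_on_nonneg[OF q f] summable[OF f] by (intro suminf_nonneg) auto
    show "(\<Sum>n. c n * q n (\<lambda>x. a * f x)) = cmod a * (\<Sum>n. c n * q n f)" for a
      using suminf_mult[OF summable[OF f], of "cmod a"] fun_seminorm_on_scale[OF q f]
      by (simp add: mult.left_commute)
    fix g assume g: "g \<in> V"
    have "(\<Sum>n. c n * q n (\<lambda>x. f x + g x)) \<le> (\<Sum>n. c n * q n f + c n * q n g)"
      using c fun_seminorm_on_add[OF q f g]
      by (intro suminf_le summable fun_subspace_add[OF V] f g summable_add)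
        (auto simp: distrib_left[symmetric] intro: mult_left_mono)
    then show "(\<Sum>n. c n * q n (\<lambda>x. f x + g x)) \<le> (\<Sum>n. c n * q n f) + (\<Sum>n. c n * q n g)"
      by (simp add: suminf_add[OF summable[OF f] summable[OF g]])
  qed
qed

text \<open>The extension is continuous because the number of terms of \<open>p\<close> that are
  alive on a step depends only on that step.\<close>

lemma distribution_extension:
  assumes I: "open I" "convex I" and T: "T \<in> dual_D I"
  obtains F where "F \<in> dual_R I" "restriction_op I F = T"
proof -
  have TD: "T \<in> extensional (space_D I)" "fun_linear_on (space_D I) T" "continuous_map (topology_D I) euclidean T"
    using T by (auto simp: dual_D_def continuous_dual_iff)
  obtain c :: "nat \<Rightarrow> real" and k :: "nat \<Rightarrow> nat" and A :: "nat \<Rightarrow> real set"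
    where "\<forall>n. 0 \<le> c n" "\<forall>n. open (A n)" "\<forall>K. compact K \<and> K \<subseteq> I \<longrightarrow> (\<exists>N. \<forall>n>N. A n \<inter> K = {})"
      and "\<forall>f\<in>space_D I. \<exists>N. cmod (T f) \<le> (\<Sum>n\<le>N. c n * G_norm_on I (A n) (k n) f)"
    using distribution_dominated[OF I TD(2,3)] by (elim exE conjE) (rule that)
  then have c: "\<And>n. 0 \<le> c n" and A: "\<And>n. open (A n)"
      "\<And>K. compact K \<Longrightarrow> K \<subseteq> I \<Longrightarrow> \<exists>N. \<forall>n>N. A n \<inter> K = {}"
    and T_le: "\<And>f. f \<in> space_D I \<Longrightarrow> \<exists>N. cmod (T f) \<le> (\<Sum>n\<le>N. c n * G_norm_on I (A n) (k n) f)"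
    by simp_all
  define q where "q n = G_norm_on I (A n) (k n)" for n
  define p where "p f = (\<Sum>n. c n * q n f)" for f
  have RG: "space_R I \<subseteq> alg_G_inf I" using space_R_subset_alg_G_inf[OF I(1)] .
  have q: "fun_seminorm_on (space_R I) (q n)" for n
    unfolding q_def by (rule fun_seminorm_on_subset[OF fun_seminorm_on_G_norm_on[OF I(1) A(1)] RG])
  have q_vanish: "q n f = 0" if "f \<in> space_R_step I K" "A n \<inter> K = {}" for n f K
  proof -
    have "f \<in> alg_G_inf I" "AE x in lebesgue. x \<in> I - K \<longrightarrow> f x = 0"
      using that by (auto simp: space_R_step_iff[OF I(1)])
    moreover from this(2) have "AE x in lebesgue. x \<in> I \<inter> A n \<longrightarrow> f x = 0"
      by eventually_elim (use that in auto)
    ultimately show ?thesis unfolding q_def by (intro G_norm_on_eq_0 I A)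
  qed
  have fin: "\<exists>N. \<forall>n>N. q n f = 0" if f: "f \<in> space_R I" for f
  proof -
    obtain K where K: "compact K" "K \<subseteq> I" "f \<in> space_R_step I K"
      using f by (auto simp: space_R_eq[OF I(1)])
    then show ?thesis using A(2)[OF K(1,2)] q_vanish by blast
  qed
  have p: "fun_seminorm_on (space_R I) p"
    unfolding p_def[abs_def] by (rule fun_seminorm_on_suminf[OF fun_subspace_R[OF I(1)] c q fin])
  have p_eq: "p f = (\<Sum>n\<le>N. c n * q n f)" if "\<forall>n>N. q n f = 0" for f N
    unfolding p_def using that by (intro suminf_finite) auto
  have "cmod (T f) \<le> p f" if f: "f \<in> space_D I" for f
  proof -
    have fR: "f \<in> space_R I" using f space_D_subset_R[OF I(1)] by blast
    obtain N where N: "\<forall>n>N. q n f = 0" using fin[OF fR] by blast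
    obtain M where "cmod (T f) \<le> (\<Sum>n\<le>M. c n * q n f)" using T_le[OF f] by (auto simp: q_def)
    \<comment> \<open>The bound for \<open>T\<close> stops at \<open>M\<close> and the series at
      \<open>N\<close>, in either order; nonnegative terms allow passing to the larger
      index.\<close>
    also have "\<dots> \<le> (\<Sum>n\<le>max M N. c n * q n f)"
      using c fun_seminorm_on_nonneg[OF q fR] by (intro sum_mono2) auto
    also have "\<dots> = p f" using N by (intro p_eq[symmetric]) auto
    finally show ?thesis .
  qed
  then obtain F0 where F0: "fun_linear_on (space_R I) F0" "\<And>f. f \<in> space_R I \<Longrightarrow> cmod (F0 f) \<le> p f"
    "\<And>f. f \<in> space_D I \<Longrightarrow> F0 f = T f"
    using complex_Hahn_Banach[OF fun_subspace_R[OF I(1)] fun_subspace_D space_D_subset_R[OF I(1)] p TD(2)]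
    by blast
  define F where "F = restrict F0 (space_R I)"
  have F: "fun_linear_on (space_R I) F" and F_le: "\<And>f. f \<in> space_R I \<Longrightarrow> cmod (F f) \<le> p f"
    using F0 fun_subspace_add[OF fun_subspace_R[OF I(1)]] fun_subspace_scale[OF fun_subspace_R[OF I(1)]]
    by (auto simp: fun_linear_on_def F_def)
  have "\<exists>m C. \<forall>f\<in>space_R_step I J. cmod (F f) \<le> C * G_norm I m f" if J: "bounded J" "closure J \<subseteq> I" for J
  proof -
    obtain N where N: "\<forall>n>N. A n \<inter> closure J = {}" using A(2) J by (metis compact_closure)
    \<comment> \<open>A sum of natural numbers, used as an upper bound for all the orders
      \<open>k n\<close> with \<open>n \<le> N\<close>.\<close>
    define m where "m = (\<Sum>n\<le>N. k n)"
    have "cmod (F f) \<le> (\<Sum>n\<le>N. c n) * G_norm I m f" if f: "f \<in> space_R_step I J" for f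
    proof -
      have fG: "f \<in> alg_G_inf I" using f space_R_step_subset_alg_G_inf[OF I(1)] by blast
      have "cmod (F f) \<le> p f" using F_le space_R_step_subset[OF I(1) J] f by blast
      also have "p f = (\<Sum>n\<le>N. c n * q n f)"
        using N q_vanish[of f "closure J"] space_R_step_mono[OF I(1) closure_subset] f by (intro p_eq) blast
      also have "\<dots> \<le> (\<Sum>n\<le>N. c n * G_norm I m f)"
      proof (intro sum_mono mult_left_mono c)
        fix n assume "n \<in> {..N}"
        then have "k n \<le> m" unfolding m_def by (intro member_le_sum) auto
        then show "q n f \<le> G_norm I m f"
          unfolding q_def using G_norm_on_mono[OF I(1) A(1) open_UNIV subset_UNIV fG, of "k n" m n]
          by (simp add: G_norm_on_UNIV)
      qed
      finally show ?thesis by (simp add: sum_distrib_right)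
    qed
    then show ?thesis by blast
  qed
  then have "F \<in> continuous_dual (space_R I) (topology_R I)"
    using F continuous_map_topology_R_iff[OF I(1) F] by (auto simp: continuous_dual_iff F_def)
  moreover have "F f = F g" if f: "f \<in> space_R I" and g: "g \<in> space_R I" and fg: "ae_eq_on I f g" for f g
  proof -
    \<comment> \<open>The difference is zero almost everywhere on \<open>I\<close>, so
      \<open>p\<close> and with it \<open>F\<close> vanish on it.\<close>
    let ?h = "\<lambda>x. f x - g x"
    have h: "?h \<in> space_R I" using fun_subspace_diff[OF fun_subspace_R[OF I(1)] f g] .
    have "AE x in lebesgue. x \<in> I \<longrightarrow> f x = g x"
      using fg unfolding ae_eq_on_def AE_lebesgue_on_open[OF I(1)] .
    then have "AE x in lebesgue. x \<in> I \<inter> A n \<longrightarrow> ?h x = 0" for n by eventually_elim auto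
    then have "q n ?h = 0" for n unfolding q_def using h RG by (intro G_norm_on_eq_0 I A) auto
    then have "p ?h = 0" by (simp add: p_def)
    then have "F ?h = 0" using F_le[OF h] by simp
    then show ?thesis using fun_linear_on_diff[OF F fun_subspace_R[OF I(1)] f g] by simp
  qed
  moreover have "restriction_op I F = T"
  proof
    show "restriction_op I F f = T f" for f
      using F0(3) TD(1) space_D_subset_R[OF I(1)]
      by (cases "f \<in> space_D I") (auto simp: restriction_op_def F_def extensional_def)
  qed
  ultimately show thesis by (intro that[of F]) (auto simp: dual_R_def)
qed

text \<open>Surjectivity is \<open>distribution_extension\<close>. The equality also records, by
  \<open>restriction_op_in_dual_D\<close>, that the operator takes its values in
  \<open>dual_D I\<close>.\<close>

theorem theorem2p7:
  fixes a b :: ereal and I :: "real set"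
  assumes "a < b" and "I = einterval a b"
  shows "space_D I \<subseteq> space_R I \<and> restriction_op I ` dual_R I = dual_D I"
proof -
  have I: "open I" "convex I" using assms by (auto simp: convex_einterval)
  have "T \<in> restriction_op I ` dual_R I" if "T \<in> dual_D I" for T
    using distribution_extension[OF I that] by blast
  then show ?thesis
    using space_D_subset_R[OF I(1)] restriction_op_in_dual_D[OF I] by blast
qed

end
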